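(* Let $p>3$ be a prime. Define the Delannoy numbers $D_n=\sum_{k=0}^n\binom{n}{k}\binom{n+k}{k}$ and the Schröder numbers $S_n=\sum_{k=0}^n\binom{n}{k}\binom{n+k}{k}\frac{1}{k+1}$. Then $$\sum_{k=1}^{p-1}D_kS_k\equiv 2p^3B_{p-3}-2pH^{*}_{p-1}\pmod{p^4},$$ where $H^{*}_n=\sum_{k=1}^{n}\frac{(-1)^k}{k}$.
   Context: $B_n$ denotes the $n$-th Bernoulli number, defined by $\frac{x}{e^x-1}=\sum_{n\ge0}B_n\frac{x^n}{n!}$. For rational numbers $a,b$, $a\equiv b\pmod{p^r}$ means $a-b=p^rc$ for some rational $c$ whose denominator is not divisible by $p$. *)

theory Defs
  imports
    Complex_Main
    "HOL-Computational_Algebra.Computational_Algebra"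
begin

text \<open>
  The Bernoulli numbers are read off from the generating function \<open>x / (e\<^sup>x - 1)\<close> as a formal
  power series.  Division of formal power series over a field cancels the common factor \<open>x\<close> of
  numerator and denominator, so this is the intended series, as \<open>bernoulli_generating_function\<close>
  confirms; in particular \<open>bernoulli 1 = - 1 / 2\<close>.
\<close>

definition bernoulli :: "nat \<Rightarrow> rat" where
  "bernoulli n = fact n * fps_nth (fps_X / (fps_exp 1 - 1)) n"

lemma bernoulli_generating_function:
  "Abs_fps (\<lambda>n. bernoulli n / fact n) * (fps_exp 1 - 1) = fps_X"
proof -
  have *: "Abs_fps (\<lambda>n. bernoulli n / fact n) = fps_X / (fps_exp 1 - 1)"
    by (rule fps_ext) (simp add: bernoulli_def)
  have 1: "fps_nth (fps_exp (1::rat) - 1) 1 \<noteq> 0"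
    by simp
  then have "subdegree (fps_exp (1::rat) - 1) \<le> subdegree (fps_X :: rat fps)"
    by (metis subdegree_leI subdegree_fps_X)
  moreover have "fps_exp (1::rat) - 1 \<noteq> 0"
    using 1 by (metis fps_zero_nth)
  ultimately have "(fps_exp (1::rat) - 1) dvd fps_X"
    by (simp add: fps_dvd_iff)
  then show ?thesis
    unfolding * by simp
qed

text \<open>Congruence of rationals modulo \<open>p ^ r\<close>, where \<open>p\<close> is meant to be a prime.\<close>

definition rat_cong :: "nat \<Rightarrow> nat \<Rightarrow> rat \<Rightarrow> rat \<Rightarrow> bool" where
  "rat_cong p r a b \<longleftrightarrow>
     (\<exists>c. a - b = of_nat p ^ r * c \<and> \<not> int p dvd snd (quotient_of c))"

definition delannoy :: "nat \<Rightarrow> nat" where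
  "delannoy n = (\<Sum>k=0..n. (n choose k) * ((n + k) choose k))"

definition schroeder :: "nat \<Rightarrow> rat" where
  "schroeder n = (\<Sum>k=0..n. of_nat (n choose k) * of_nat ((n + k) choose k) * (1 / of_nat (k + 1)))"

definition alt_harm :: "nat \<Rightarrow> rat" where
  "alt_harm n = (\<Sum>k=1..n. (-1) ^ k / of_nat k)"

end

theory Submission
  imports Defs
begin

text \<open>
  Write \<open>D\<^sub>n(x) = \<Sum> (n choose k) (n + k choose k) x\<^sup>k\<close> (a shifted Legendre polynomial) and
  \<open>F\<^sub>n(x) = \<integral>\<^sub>0\<^sup>x D\<^sub>n\<close>, so that \<open>D\<^sub>n = D\<^sub>n(1)\<close> and \<open>S\<^sub>n = F\<^sub>n(1)\<close>.  The Legendre relations show that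
  \<open>(n + 1) D\<^sub>n F\<^sub>n - (n - 1) D\<^bsub>n-1\<^esub> F\<^bsub>n-1\<^esub>\<close> is a primitive of
  \<open>(2 n + 1) D\<^sub>n\<^sup>2 - (2 n - 1) D\<^bsub>n-1\<^esub>\<^sup>2\<close>; summing over \<open>n\<close> gives the exact formula
  \<open>\<Sum> D\<^sub>k S\<^sub>k = (2 p - 1) \<integral>\<^sub>0\<^sup>1 D\<^bsub>p-1\<^esub>(x)\<^sup>2 dx - 1 - (p - 1) D\<^bsub>p-1\<^esub> S\<^bsub>p-1\<^esub>\<close> for \<open>1 \<le> k < p\<close>.
  All nonconstant coefficients of \<open>D\<^bsub>p-1\<^esub>(x)\<close> are divisible by \<open>p\<close>, the \<open>k\<close>-th one being
  \<open>(-1)\<^sup>k p / (p + k) \<Prod> (1 - p\<^sup>2 / i\<^sup>2)\<close> over \<open>1 \<le> i \<le> k\<close>.  Modulo \<open>p\<^sup>4\<close> the product only matters in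
  single sums, and integration by parts reduces the remaining double sum to single sums as well,
  up to a term that vanishes by the reflection \<open>k \<mapsto> p - k\<close>.  All single sums reduce to \<open>H\<^sup>*\<close> and
  \<open>\<Sum> (-1)\<^sup>k / k\<^sup>3\<close>, and the latter is \<open>- B\<^bsub>p-3\<^esub> / 2\<close> modulo \<open>p\<close>.
\<close>

section \<open>The exact formula\<close>

text \<open>The integral over [0, 1], taken as a linear functional on coefficients so that
  everything stays rational and finite.\<close>

definition poly_integral :: "rat poly \<Rightarrow> rat" where
  "poly_integral q = (\<Sum>i\<le>degree q. coeff q i / of_nat (Suc i))"

lemma poly_integral_eq:
  assumes "degree q \<le> n"
  shows "poly_integral q = (\<Sum>i\<le>n. coeff q i / of_nat (Suc i))"
  unfolding poly_integral_def using assms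
  by (intro sum.mono_neutral_left) (auto simp: coeff_eq_0)

lemma poly_integral_0 [simp]: "poly_integral 0 = 0"
  by (simp add: poly_integral_def)

lemma poly_integral_add: "poly_integral (q + r) = poly_integral q + poly_integral r"
proof -
  define n where "n = max (degree q) (degree r)"
  have "degree (q + r) \<le> n" "degree q \<le> n" "degree r \<le> n"
    by (auto simp: n_def degree_add_le_max)
  then show ?thesis
    by (simp add: poly_integral_eq[of _ n] add_divide_distrib sum.distrib)
qed

lemma poly_integral_smult: "poly_integral (smult c q) = c * poly_integral q"
  using poly_integral_eq[of "smult c q" "degree q"]
  by (simp add: poly_integral_def sum_distrib_left degree_smult_le)

lemma poly_integral_of_nat_mult: "poly_integral (of_nat n * q) = of_nat n * poly_integral q"
  using poly_integral_smult[of "of_nat n" q] by (simp add: of_nat_poly)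

lemma poly_integral_diff: "poly_integral (q - r) = poly_integral q - poly_integral r"
  using poly_integral_add[of q "smult (- 1) r"] poly_integral_smult[of "- 1" r] by simp

lemma poly_integral_sum: "poly_integral (sum f A) = (\<Sum>i\<in>A. poly_integral (f i))"
  by (induction A rule: infinite_finite_induct) (simp_all add: poly_integral_add)

lemma poly_integral_monom: "poly_integral (monom c n) = c / of_nat (Suc n)"
proof -
  have "poly_integral (monom c n) = (\<Sum>i\<le>n. if i = n then c / of_nat (Suc n) else 0)"
    unfolding poly_integral_eq[OF degree_monom_le] by (intro sum.cong) auto
  then show ?thesis by simp
qed

text \<open>Fundamental theorem of calculus: both sides are the sum of the nonconstant coefficients
  of \<open>q\<close>.\<close>

lemma poly_integral_pderiv: "poly_integral (pderiv q) = poly q 1 - poly q 0"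
proof -
  have "poly_integral (pderiv q) = (\<Sum>i\<le>degree q. coeff q (Suc i))"
    by (subst poly_integral_eq[of _ "degree q"])
       (auto simp: degree_pderiv coeff_pderiv simp del: of_nat_Suc intro!: sum.cong)
  also have "\<dots> = (\<Sum>i\<le>Suc (degree q). coeff q i) - coeff q 0"
    by (subst sum.atMost_Suc_shift) simp
  also have "\<dots> = poly q 1 - poly q 0"
    by (simp add: poly_altdef[of q 1] poly_0_coeff_0 coeff_eq_0)
  finally show ?thesis .
qed

section \<open>Coefficients of the shifted Legendre polynomials and their ratio recurrences\<close>

definition delannoy_coeff :: "nat \<Rightarrow> nat \<Rightarrow> rat" where
  "delannoy_coeff n k = of_nat ((n choose k) * ((n + k) choose k))"

lemma delannoy_coeff_0 [simp]: "delannoy_coeff n 0 = 1"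
  by (simp add: delannoy_coeff_def)

lemma delannoy_coeff_eq_0: "n < k \<Longrightarrow> delannoy_coeff n k = 0"
  by (simp add: delannoy_coeff_def)

text \<open>Writing \<open>n = k + d\<close> avoids truncated subtraction and exhibits a multinomial
  coefficient; the three recurrences below then follow by cancelling factorials.\<close>

lemma delannoy_coeff_fact:
  "delannoy_coeff (k + d) k = fact (2 * k + d) / (fact k ^ 2 * fact d)"
  by (simp add: delannoy_coeff_def binomial_fact power2_eq_square field_simps flip: mult_2)

lemma delannoy_coeff_Suc_right:
  "of_nat (Suc k) ^ 2 * delannoy_coeff n (Suc k) =
     (of_nat n - of_nat k) * (of_nat n + of_nat k + 1) * delannoy_coeff n k"
proof (cases "Suc k \<le> n")
  case True
  then obtain d where n: "n = Suc k + d" using le_Suc_ex by blast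
  have 1: "delannoy_coeff n k = fact (2 * k + Suc d) / (fact k ^ 2 * fact (Suc d))"
    using delannoy_coeff_fact[of k "Suc d"] n by simp
  have 2: "delannoy_coeff n (Suc k) = fact (2 * Suc k + d) / (fact (Suc k) ^ 2 * fact d)"
    using delannoy_coeff_fact[of "Suc k" d] n by simp
  show ?thesis unfolding 1 2 by (simp add: n divide_simps)
next
  case False
  \<comment> \<open>At the edge \<open>n = k\<close> of the support the factor \<open>n - k\<close>
    kills the right-hand side; beyond it both coefficients are 0.\<close>
  then consider "n = k" | "n < k" by linarith
  then show ?thesis by cases (auto simp: delannoy_coeff_eq_0)
qed

lemma delannoy_coeff_Suc_left:
  "(of_nat n + of_nat k + 1) * delannoy_coeff n k = (of_nat n + 1 - of_nat k) * delannoy_coeff (Suc n) k"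
proof (cases "k \<le> n")
  case True
  then obtain d where n: "n = k + d" using le_Suc_ex by blast
  have 1: "delannoy_coeff (Suc n) k = fact (2 * k + Suc d) / (fact k ^ 2 * fact (Suc d))"
    using delannoy_coeff_fact[of k "Suc d"] n by simp
  have 2: "delannoy_coeff n k = fact (2 * k + d) / (fact k ^ 2 * fact d)"
    using delannoy_coeff_fact[of k d] n by simp
  show ?thesis unfolding 1 2 by (simp add: n divide_simps) (simp add: algebra_simps power2_eq_square)
next
  case False
  then consider "k = Suc n" | "Suc n < k" by linarith
  then show ?thesis by cases (auto simp: delannoy_coeff_eq_0)
qed

lemma delannoy_coeff_Suc_Suc:
  "of_nat (Suc k) ^ 2 * delannoy_coeff (Suc n) (Suc k) =
     (of_nat n + of_nat k + 1) * (of_nat n + of_nat k + 2) * delannoy_coeff n k"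
proof (cases "k \<le> n")
  case True
  then obtain d where n: "n = k + d" using le_Suc_ex by blast
  have 1: "delannoy_coeff (Suc n) (Suc k) = fact (2 * Suc k + d) / (fact (Suc k) ^ 2 * fact d)"
    using delannoy_coeff_fact[of "Suc k" "d"] n by simp
  have 2: "delannoy_coeff n k = fact (2 * k + d) / (fact k ^ 2 * fact d)"
    using delannoy_coeff_fact[of k d] n by simp
  show ?thesis unfolding 1 2 by (simp add: n divide_simps) (simp add: algebra_simps power2_eq_square)
qed (simp add: delannoy_coeff_eq_0)

section \<open>The polynomials \<open>D\<^sub>n(x)\<close> and \<open>F\<^sub>n(x)\<close> and the
  Legendre relations\<close>

definition delannoy_poly :: "nat \<Rightarrow> rat poly" where
  "delannoy_poly n = (\<Sum>k\<le>n. monom (delannoy_coeff n k) k)"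

definition schroeder_poly :: "nat \<Rightarrow> rat poly" where
  "schroeder_poly n = (\<Sum>k\<le>n. monom (delannoy_coeff n k / of_nat (Suc k)) (Suc k))"

lemma coeff_delannoy_poly [simp]: "coeff (delannoy_poly n) k = delannoy_coeff n k"
  by (simp add: delannoy_poly_def coeff_sum delannoy_coeff_eq_0)

lemma coeff_schroeder_poly_0 [simp]: "coeff (schroeder_poly n) 0 = 0"
  by (simp add: schroeder_poly_def coeff_sum)

lemma coeff_schroeder_poly_Suc [simp]:
  "coeff (schroeder_poly n) (Suc k) = delannoy_coeff n k / of_nat (Suc k)"
  by (simp add: schroeder_poly_def coeff_sum delannoy_coeff_eq_0)

lemma poly_delannoy_poly_1: "poly (delannoy_poly n) 1 = of_nat (delannoy n)"
  by (simp add: delannoy_poly_def poly_sum poly_monom delannoy_def delannoy_coeff_def atMost_atLeast0)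

lemma poly_schroeder_poly_1: "poly (schroeder_poly n) 1 = schroeder n"
  by (simp add: schroeder_poly_def poly_sum poly_monom schroeder_def delannoy_coeff_def atMost_atLeast0)

lemma poly_schroeder_poly_0: "poly (schroeder_poly n) 0 = 0"
  by (simp add: poly_0_coeff_0)

text \<open>With z = 1 + 2x one has 4x(1 + x) = z^2 - 1 and d/dx = 2 d/dz, so this is the Legendre
  relation (z^2 - 1) P_m' = m (z P_m - P_(m-1)) for m = n + 1.\<close>

lemma delannoy_poly_pderiv:
  "2 * [:0, 1, 1:] * pderiv (delannoy_poly (Suc n)) =
     of_nat (Suc n) * ([:1, 2:] * delannoy_poly (Suc n) - delannoy_poly n)"
proof (rule poly_eqI)
  fix k
  show "coeff (2 * [:0, 1, 1:] * pderiv (delannoy_poly (Suc n))) k =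
     coeff (of_nat (Suc n) * ([:1, 2:] * delannoy_poly (Suc n) - delannoy_poly n)) k"
  proof (cases k)
    case 0
    then show ?thesis by (simp add: numeral_poly of_nat_poly)
  next
    case (Suc j)
    have L: "coeff (2 * [:0, 1, 1:] * pderiv (delannoy_poly (Suc n))) (Suc j) =
        2 * (of_nat (Suc j) * delannoy_coeff (Suc n) (Suc j) + of_nat j * delannoy_coeff (Suc n) j)"
      by (cases j) (simp_all add: numeral_poly coeff_pderiv algebra_simps)
    have R: "coeff (of_nat (Suc n) * ([:1, 2:] * delannoy_poly (Suc n) - delannoy_poly n)) (Suc j) =
        of_nat (Suc n) * (delannoy_coeff (Suc n) (Suc j) + 2 * delannoy_coeff (Suc n) j
          - delannoy_coeff n (Suc j))"
      by (simp add: of_nat_poly algebra_simps)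
    define u v w N J where "u = delannoy_coeff (Suc n) (Suc j)" and "v = delannoy_coeff (Suc n) j"
      and "w = delannoy_coeff n (Suc j)" and "N = (of_nat n :: rat)" and "J = (of_nat j :: rat)"
    have 1: "(J + 1)^2 * u = (N + 1 - J) * (N + J + 2) * v"
      using delannoy_coeff_Suc_right[of j "Suc n"] by (simp add: u_def v_def N_def J_def algebra_simps)
    have 2: "(N + J + 2) * w = (N - J) * u"
      using delannoy_coeff_Suc_left[of n "Suc j"] by (simp add: u_def w_def N_def J_def algebra_simps)
    \<comment> \<open>Multiplying by this nonzero factor allows \<open>w\<close> to be eliminated by
      2; what remains is a multiple of 1.\<close>
    have "N + J + 2 > 0" by (simp add: N_def J_def)
    moreover have "(N + J + 2) * (2 * ((J + 1) * u + J * v)) = (N + J + 2) * ((N + 1) * (u + 2 * v - w))"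
      using 1 2 by algebra
    ultimately have "2 * ((J + 1) * u + J * v) = (N + 1) * (u + 2 * v - w)" by simp
    then show ?thesis unfolding Suc L R
      by (simp add: u_def v_def w_def N_def J_def add.commute)
  qed
qed

text \<open>The companion Legendre relation (z^2 - 1) P_n' = (n + 1) (P_(n+1) - z P_n), again with z
  = 1 + 2x.\<close>

lemma delannoy_poly_pderiv':
  "2 * [:0, 1, 1:] * pderiv (delannoy_poly n) =
     of_nat (Suc n) * (delannoy_poly (Suc n) - [:1, 2:] * delannoy_poly n)"
proof (rule poly_eqI)
  fix k
  show "coeff (2 * [:0, 1, 1:] * pderiv (delannoy_poly n)) k =
     coeff (of_nat (Suc n) * (delannoy_poly (Suc n) - [:1, 2:] * delannoy_poly n)) k"
  proof (cases k)
    case 0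
    then show ?thesis by (simp add: numeral_poly of_nat_poly)
  next
    case (Suc j)
    have L: "coeff (2 * [:0, 1, 1:] * pderiv (delannoy_poly n)) (Suc j) =
        2 * (of_nat (Suc j) * delannoy_coeff n (Suc j) + of_nat j * delannoy_coeff n j)"
      by (cases j) (simp_all add: numeral_poly coeff_pderiv algebra_simps)
    have R: "coeff (of_nat (Suc n) * (delannoy_poly (Suc n) - [:1, 2:] * delannoy_poly n)) (Suc j) =
        of_nat (Suc n) * (delannoy_coeff (Suc n) (Suc j) - 2 * delannoy_coeff n j
          - delannoy_coeff n (Suc j))"
      by (simp add: of_nat_poly algebra_simps)
    define u v w N J where "u = delannoy_coeff (Suc n) (Suc j)" and "v = delannoy_coeff n j"
      and "w = delannoy_coeff n (Suc j)" and "N = (of_nat n :: rat)" and "J = (of_nat j :: rat)"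
    have 1: "(J + 1)^2 * w = (N - J) * (N + J + 1) * v"
      using delannoy_coeff_Suc_right[of j n] by (simp add: w_def v_def N_def J_def algebra_simps)
    have 2: "(J + 1)^2 * u = (N + J + 1) * (N + J + 2) * v"
      using delannoy_coeff_Suc_Suc[of j n] by (simp add: u_def v_def N_def J_def algebra_simps)
    have "(J + 1)^2 > 0" by (simp add: J_def)
    moreover have "(J + 1)^2 * (2 * ((J + 1) * w + J * v)) = (J + 1)^2 * ((N + 1) * (u - 2 * v - w))"
      using 1 2 by algebra
    ultimately have "2 * ((J + 1) * w + J * v) = (N + 1) * (u - 2 * v - w)" by simp
    then show ?thesis unfolding Suc L R
      by (simp add: u_def v_def w_def N_def J_def add.commute)
  qed
qed

text \<open>Legendre's differential equation (x(1 + x) D_n')' = n(n + 1) D_n, integrated once from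
  0.\<close>

lemma schroeder_poly_eq:
  "of_nat (n * Suc n) * schroeder_poly n = [:0, 1, 1:] * pderiv (delannoy_poly n)"
proof (rule poly_eqI)
  fix k
  show "coeff (of_nat (n * Suc n) * schroeder_poly n) k =
     coeff ([:0, 1, 1:] * pderiv (delannoy_poly n)) k"
  proof (cases k)
    case 0
    then show ?thesis by (simp add: of_nat_poly)
  next
    case (Suc j)
    have L: "coeff (of_nat (n * Suc n) * schroeder_poly n) (Suc j) =
        of_nat (n * Suc n) * (delannoy_coeff n j / of_nat (Suc j))"
      by (simp add: of_nat_poly)
    have R: "coeff ([:0, 1, 1:] * pderiv (delannoy_poly n)) (Suc j) =
        of_nat (Suc j) * delannoy_coeff n (Suc j) + of_nat j * delannoy_coeff n j"
      by (cases j) (simp_all add: coeff_pderiv)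
    define v w N J where "v = delannoy_coeff n j"
      and "w = delannoy_coeff n (Suc j)" and "N = (of_nat n :: rat)" and "J = (of_nat j :: rat)"
    have 1: "(J + 1)^2 * w = (N - J) * (N + J + 1) * v"
      using delannoy_coeff_Suc_right[of j n] by (simp add: w_def v_def N_def J_def algebra_simps)
    have "J + 1 > 0" by (simp add: J_def)
    moreover have "(J + 1) * ((J + 1) * w + J * v) = N * (N + 1) * v"
      using 1 by algebra
    ultimately have "N * (N + 1) * (v / (J + 1)) = (J + 1) * w + J * v"
      by (simp add: field_simps)
    then show ?thesis unfolding Suc L R
      by (simp add: v_def w_def N_def J_def add.commute distrib_left)
  qed
qed

text \<open>By the Legendre relations the antiderivatives \<open>F\<close> and \<open>E\<close> are
  combinations of the neighbours \<open>A\<close> and \<open>B\<close>, so twice the bracket is a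
  quadratic form in \<open>A\<close> and \<open>B\<close> alone. Differentiating it and using the
  relations once more removes all derivatives.\<close>

lemma delannoy_schroeder_pderiv:
  "pderiv (of_nat (n + 2) * (delannoy_poly (Suc n) * schroeder_poly (Suc n))
      - of_nat n * (delannoy_poly n * schroeder_poly n))
   = of_nat (2 * n + 3) * delannoy_poly (Suc n) ^ 2 - of_nat (2 * n + 1) * delannoy_poly n ^ 2"
  (is "pderiv ?G = ?R")
proof -
  define Y Z :: "rat poly" where "Y = [:0, 1, 1:]" and "Z = [:1, 2:]"
  define A B where "A = delannoy_poly (Suc n)" and "B = delannoy_poly n"
  define F E where "F = schroeder_poly (Suc n)" and "E = schroeder_poly n"
  define N :: "rat poly" where "N = of_nat (Suc n)"
  have YZ: "Z ^ 2 = 4 * Y + 1"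
    by (simp add: Y_def Z_def power2_eq_square numeral_poly one_pCons)
  have dZ: "pderiv Z = 2" by (simp add: Z_def pderiv_pCons numeral_poly)
  have N0: "N \<noteq> 0" unfolding N_def by (metis of_nat_eq_0_iff nat.distinct(1))
  have Y0: "Y \<noteq> 0" by (simp add: Y_def)
  have 1: "2 * Y * pderiv A = N * (Z * A - B)"
    using delannoy_poly_pderiv[of n] by (simp only: Y_def Z_def A_def B_def N_def)
  have 2: "2 * Y * pderiv B = N * (A - Z * B)"
    using delannoy_poly_pderiv'[of n] by (simp only: Y_def Z_def A_def B_def N_def)
  have 3: "N * (N + 1) * F = Y * pderiv A"
    using schroeder_poly_eq[of "Suc n"] by (simp add: Y_def F_def A_def N_def algebra_simps)
  have 4: "(N - 1) * N * E = Y * pderiv B"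
    using schroeder_poly_eq[of n] by (simp add: Y_def E_def B_def N_def algebra_simps)
  have "N * (2 * (N + 1) * F) = N * (Z * A - B)" using 1 3 by algebra
  then have 5: "2 * (N + 1) * F = Z * A - B" using N0 by simp
  have "N * (2 * (N - 1) * E) = N * (A - Z * B)" using 2 4 by algebra
  then have 6: "2 * (N - 1) * E = A - Z * B" using N0 by simp
  have G: "2 * ?G = Z * A ^ 2 - 2 * A * B + Z * B ^ 2"
  proof -
    have "?G = (N + 1) * (A * F) - (N - 1) * (B * E)"
      by (simp add: A_def B_def F_def E_def N_def algebra_simps)
    then show ?thesis using 5 6 by algebra
  qed
  \<comment> \<open>The cross terms of (ZA - B)^2 and (A - ZB)^2 agree, which leaves (Z^2 - 1)(A^2 -
    B^2), and Z^2 - 1 = 4Y.\<close>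
  have "4 * Y * (Y * (pderiv A ^ 2 - pderiv B ^ 2)) = (2 * Y * pderiv A) ^ 2 - (2 * Y * pderiv B) ^ 2"
    by algebra
  also have "\<dots> = N ^ 2 * ((Z ^ 2 - 1) * (A ^ 2 - B ^ 2))"
    unfolding 1 2 by algebra
  also have "\<dots> = 4 * Y * (N ^ 2 * (A ^ 2 - B ^ 2))"
    unfolding YZ by algebra
  finally have "4 * Y * (Y * (pderiv A ^ 2 - pderiv B ^ 2)) = 4 * Y * (N ^ 2 * (A ^ 2 - B ^ 2))" .
  then have 7: "Y * (pderiv A ^ 2 - pderiv B ^ 2) = N ^ 2 * (A ^ 2 - B ^ 2)"
    using Y0 by simp
  have "2 * pderiv ?G = pderiv (2 * ?G)"
    by (simp only: mult_2 pderiv_add)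
  also have "2 * ?G = Z * (A * A) - (A * B + A * B) + Z * (B * B)"
    unfolding G by algebra
  also have "pderiv \<dots> = 2 * (A ^ 2 + B ^ 2) + 2 * pderiv A * (Z * A - B) + 2 * pderiv B * (Z * B - A)"
    unfolding pderiv_add pderiv_diff pderiv_mult dZ by algebra
  finally have 8: "2 * pderiv ?G =
    2 * (A ^ 2 + B ^ 2) + 2 * pderiv A * (Z * A - B) + 2 * pderiv B * (Z * B - A)" .
  have R: "?R = (2 * N + 1) * A ^ 2 - (2 * N - 1) * B ^ 2"
    by (simp add: A_def B_def N_def algebra_simps)
  \<comment> \<open>The factor \<open>N\<close> allows relations 1 and 2 to be read backwards, so
    that the terms with derivatives collapse to the difference of squares in 7.\<close>
  have "(2 * N) * pderiv ?G = N * (2 * pderiv ?G)" by algebra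
  also have "\<dots> = 2 * N * (A ^ 2 + B ^ 2) + 2 * pderiv A * (N * (Z * A - B)) - 2 * pderiv B * (N * (A - Z * B))"
    unfolding 8 by algebra
  also have "\<dots> = 2 * N * (A ^ 2 + B ^ 2) + 4 * (Y * (pderiv A ^ 2 - pderiv B ^ 2))"
    unfolding 1[symmetric] 2[symmetric] by algebra
  also have "\<dots> = (2 * N) * ?R" unfolding 7 R by algebra
  finally have "(2 * N) * pderiv ?G = (2 * N) * ?R" .
  then show ?thesis using N0 by simp
qed

text \<open>Integrating the preceding identity over [0, 1] gives the induction step, since the
  antiderivatives vanish at 0. The constant - 1 comes from \<open>n = 0\<close>, where the integral
  is 1 and the sum is empty.\<close>

lemma sum_delannoy_schroeder:
  "(\<Sum>k=1..n. of_nat (delannoy k) * schroeder k) =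
     of_nat (2 * n + 1) * poly_integral (delannoy_poly n ^ 2) - 1
       - of_nat n * of_nat (delannoy n) * schroeder n"
proof (induction n)
  case 0
  have "delannoy_poly 0 = 1"
    by (simp add: delannoy_poly_def monom_0 one_pCons)
  then have "delannoy_poly 0 ^ 2 = 1" by simp
  moreover have "poly_integral 1 = 1"
    using poly_integral_monom[of 1 0] by (simp add: monom_0 flip: one_pCons)
  ultimately show ?case by simp
next
  case (Suc n)
  define X where "X n = of_nat (delannoy n) * schroeder n" for n
  define J where "J n = poly_integral (delannoy_poly n ^ 2)" for n
  have "poly_integral (of_nat (2 * n + 3) * delannoy_poly (Suc n) ^ 2
      - of_nat (2 * n + 1) * delannoy_poly n ^ 2) = of_nat (n + 2) * X (Suc n) - of_nat n * X n"
    unfolding delannoy_schroeder_pderiv[symmetric] poly_integral_pderiv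
    by (simp add: poly_delannoy_poly_1 poly_schroeder_poly_1 poly_schroeder_poly_0 X_def del: of_nat_add)
  then have "of_nat (2 * n + 3) * J (Suc n) - of_nat (2 * n + 1) * J n
      = of_nat (n + 2) * X (Suc n) - of_nat n * X n"
    by (simp only: poly_integral_diff poly_integral_of_nat_mult J_def)
  then have 1: "(2 * of_nat n + 3) * J (Suc n) - (2 * of_nat n + 1) * J n
      = (of_nat n + 2) * X (Suc n) - of_nat n * X n"
    by (simp add: add.commute)
  have 2: "(\<Sum>k=1..n. X k) = (2 * of_nat n + 1) * J n - 1 - of_nat n * X n"
    using Suc by (simp add: X_def J_def mult.assoc)
  have "(\<Sum>k=1..Suc n. X k) = (\<Sum>k=1..n. X k) + X (Suc n)" by simp
  also have "\<dots> = (2 * of_nat n + 3) * J (Suc n) - 1 - (of_nat n + 1) * X (Suc n)"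
    using 1 2 by algebra
  also have "2 * of_nat n + 3 = (of_nat (2 * Suc n + 1) :: rat)" by simp
  also have "of_nat n + 1 = (of_nat (Suc n) :: rat)" by simp
  finally show ?case by (simp only: X_def J_def mult.assoc)
qed

lemma poly_integral_delannoy_poly_square:
  "poly_integral (delannoy_poly n ^ 2) =
     (\<Sum>j\<le>n. \<Sum>k\<le>n. delannoy_coeff n j * delannoy_coeff n k / of_nat (Suc (j + k)))"
  by (simp add: delannoy_poly_def power2_eq_square sum_product mult_monom poly_integral_sum
      poly_integral_monom)

text \<open>The value of \<open>schroeder_poly_eq\<close> at 1, where x(1 + x) = 2. It trades the
  denominators \<open>k + 1\<close>, one of which is \<open>p\<close> when \<open>n = p - 1\<close>,
  for factors \<open>k\<close>.\<close>

lemma schroeder_eq_sum: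
  assumes "n > 0"
  shows "of_nat n * of_nat (Suc n) * schroeder n = 2 * (\<Sum>k\<le>n. of_nat k * delannoy_coeff n k)"
proof -
  have "of_nat (n * Suc n) * schroeder n = poly (of_nat (n * Suc n) * schroeder_poly n) 1"
    by (simp add: poly_schroeder_poly_1)
  also have "\<dots> = 2 * poly (pderiv (delannoy_poly n)) 1"
    unfolding schroeder_poly_eq by simp
  \<comment> \<open>For \<open>k = 0\<close> the truncated exponent does no harm because the
    coefficient is 0.\<close>
  also have "pderiv (delannoy_poly n) = (\<Sum>k\<le>n. monom (of_nat k * delannoy_coeff n k) (k - 1))"
  proof (rule poly_eqI)
    fix i
    have "coeff (\<Sum>k\<le>n. monom (of_nat k * delannoy_coeff n k) (k - 1)) i =
        (\<Sum>k\<le>n. if k = Suc i then of_nat k * delannoy_coeff n k else 0)"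
      unfolding coeff_sum by (intro sum.cong) auto
    then show "coeff (pderiv (delannoy_poly n)) i =
        coeff (\<Sum>k\<le>n. monom (of_nat k * delannoy_coeff n k) (k - 1)) i"
      by (simp add: coeff_pderiv delannoy_coeff_eq_0 del: of_nat_Suc)
  qed
  also have "poly \<dots> 1 = (\<Sum>k\<le>n. of_nat k * delannoy_coeff n k)"
    by (simp add: poly_sum poly_monom)
  finally show ?thesis by (simp only: of_nat_mult)
qed

section \<open>Rational numbers of bounded below \<open>p\<close>-adic valuation\<close>

text \<open>For prime \<open>p\<close> this is the ideal p^r Z_(p), that is, 0 and the rationals of
  p-adic valuation at least \<open>r\<close>. Congruences become membership of the
  difference.\<close>

definition padic_ideal :: "nat \<Rightarrow> nat \<Rightarrow> rat set" where
  "padic_ideal p r = {x. rat_cong p r x 0}"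

lemma rat_cong_iff_diff: "rat_cong p r a b \<longleftrightarrow> a - b \<in> padic_ideal p r"
  by (simp add: padic_ideal_def rat_cong_def)

locale prime_padic =
  fixes p :: nat
  assumes prime_p: "prime p"
begin

abbreviation (input) Ord :: "nat \<Rightarrow> rat set" where "Ord r \<equiv> padic_ideal p r"

text \<open>The reduced denominator divides every other one, so any fraction with denominator prime
  to \<open>p\<close> certifies membership. In this form closure under sums and products is mere
  cross-multiplication.\<close>

lemma mem_Ord_iff:
  "x \<in> Ord r \<longleftrightarrow> (\<exists>a b. \<not> int p dvd b \<and> x * of_int b = of_nat p ^ r * of_int a)"
proof
  assume "x \<in> Ord r"
  then obtain c where c: "x = of_nat p ^ r * c" "\<not> int p dvd snd (quotient_of c)"
    by (auto simp: padic_ideal_def rat_cong_def)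
  obtain a b where ab: "quotient_of c = (a, b)" by (cases "quotient_of c")
  then have "b > 0" "c = of_int a / of_int b"
    using quotient_of_denom_pos quotient_of_div by blast+
  then have "x * of_int b = of_nat p ^ r * of_int a" using c by simp
  then show "\<exists>a b. \<not> int p dvd b \<and> x * of_int b = of_nat p ^ r * of_int a"
    using c ab by auto
next
  assume "\<exists>a b. \<not> int p dvd b \<and> x * of_int b = of_nat p ^ r * of_int a"
  then obtain a b where ab: "\<not> int p dvd b" "x * of_int b = of_nat p ^ r * of_int a" by auto
  define c :: rat where "c = of_int a / of_int b"
  have b0: "b \<noteq> 0" using ab(1) by auto
  have "x = of_nat p ^ r * c" using ab(2) b0 by (simp add: c_def field_simps)
  moreover have "snd (quotient_of c) dvd b"
  proof -
    obtain u v where uv: "quotient_of c = (u, v)" by (cases "quotient_of c")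
    then have v: "v > 0" "coprime u v" "c = of_int u / of_int v"
      using quotient_of_denom_pos quotient_of_coprime quotient_of_div by blast+
    then have "of_int u * of_int b = (of_int a * of_int v :: rat)"
      using b0 by (simp add: c_def field_simps)
    then have "u * b = a * v" by (metis of_int_eq_iff of_int_mult)
    then have "v dvd u * b" by simp
    then show ?thesis using uv v(2) by (simp add: coprime_commute coprime_dvd_mult_right_iff)
  qed
  ultimately show "x \<in> Ord r"
    using ab(1) by (auto simp: padic_ideal_def rat_cong_def dest: dvd_trans)
qed

lemma p_neq_0 [simp]: "p \<noteq> 0" "(of_nat p :: rat) \<noteq> 0"
  using prime_p by auto

lemma prime_int_p: "prime (int p)" using prime_p by simp

lemma Ord_add: assumes "x \<in> Ord r" "y \<in> Ord r" shows "x + y \<in> Ord r"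
proof -
  obtain a b where 1: "\<not> int p dvd b" "x * of_int b = of_nat p ^ r * of_int a"
    using assms(1) mem_Ord_iff by blast
  obtain c d where 2: "\<not> int p dvd d" "y * of_int d = of_nat p ^ r * of_int c"
    using assms(2) mem_Ord_iff by blast
  have "\<not> int p dvd b * d" using 1 2 prime_int_p by (simp add: prime_dvd_mult_iff)
  moreover have "(x + y) * of_int (b * d) = (x * of_int b) * of_int d + (y * of_int d) * of_int b"
    by (simp add: algebra_simps)
  then have "(x + y) * of_int (b * d) = of_nat p ^ r * of_int (a * d + c * b)"
    unfolding 1(2) 2(2) by (simp add: algebra_simps)
  ultimately show ?thesis using mem_Ord_iff by blast
qed

lemma Ord_mult: assumes "x \<in> Ord r" "y \<in> Ord s" shows "x * y \<in> Ord (r + s)"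
proof -
  obtain a b where 1: "\<not> int p dvd b" "x * of_int b = of_nat p ^ r * of_int a"
    using assms(1) mem_Ord_iff by blast
  obtain c d where 2: "\<not> int p dvd d" "y * of_int d = of_nat p ^ s * of_int c"
    using assms(2) mem_Ord_iff by blast
  have "\<not> int p dvd b * d" using 1 2 prime_int_p by (simp add: prime_dvd_mult_iff)
  moreover have "(x * y) * of_int (b * d) = (x * of_int b) * (y * of_int d)"
    by (simp add: algebra_simps)
  then have "(x * y) * of_int (b * d) = of_nat p ^ (r + s) * of_int (a * c)"
    unfolding 1(2) 2(2) by (simp add: algebra_simps power_add)
  ultimately show ?thesis using mem_Ord_iff by blast
qed

lemma Ord_mult_eq: "x \<in> Ord r \<Longrightarrow> y \<in> Ord s \<Longrightarrow> r + s = t \<Longrightarrow> x * y \<in> Ord t"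
  using Ord_mult by blast

lemma Ord_of_int [simp]: "of_int a \<in> Ord 0"
  using mem_Ord_iff[of "of_int a" 0] prime_int_p
  by (metis mult_1 mult_1_right not_prime_unit of_int_1 power_0)

lemma Ord_of_nat [simp]: "of_nat a \<in> Ord 0" using Ord_of_int[of "int a"] by simp

lemma Ord_numeral [simp]: "numeral a \<in> Ord 0" using Ord_of_int[of "numeral a"] by simp

lemma Ord_1 [simp]: "1 \<in> Ord 0" using Ord_of_int[of 1] by simp

lemma Ord_0 [simp]: "0 \<in> Ord r"
  unfolding mem_Ord_iff using prime_int_p
  by (intro exI[of _ 0] exI[of _ 1]) auto

lemma Ord_p_power [simp]: "of_nat p ^ r \<in> Ord r"
  unfolding mem_Ord_iff using prime_int_p
  by (intro exI[of _ 1]) auto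

lemma Ord_p [simp]: "of_nat p \<in> Ord 1" using Ord_p_power[of 1] by simp

lemma Ord_mult_left: "x \<in> Ord 0 \<Longrightarrow> y \<in> Ord r \<Longrightarrow> x * y \<in> Ord r"
  using Ord_mult[of x 0 y r] by simp

lemma Ord_mult_right: "x \<in> Ord r \<Longrightarrow> y \<in> Ord 0 \<Longrightarrow> x * y \<in> Ord r"
  using Ord_mult[of x r y 0] by simp

lemma Ord_uminus: "x \<in> Ord r \<Longrightarrow> - x \<in> Ord r"
  using Ord_mult_left[of "- 1" x r] Ord_of_int[of "- 1"] by simp

lemma Ord_minus_one_power: "x \<in> Ord r \<Longrightarrow> (- 1) ^ k * x \<in> Ord r"
  by (cases "even k") (auto intro: Ord_uminus)

lemma Ord_diff: "x \<in> Ord r \<Longrightarrow> y \<in> Ord r \<Longrightarrow> x - y \<in> Ord r"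
  using Ord_add[OF _ Ord_uminus, of x r y] by simp

lemma Ord_sum: "(\<And>i. i \<in> A \<Longrightarrow> f i \<in> Ord r) \<Longrightarrow> sum f A \<in> Ord r"
  by (induction A rule: infinite_finite_induct) (auto intro: Ord_add)

lemma Ord_power: "x \<in> Ord 0 \<Longrightarrow> x ^ n \<in> Ord 0"
  by (induction n) (auto intro: Ord_mult_left)

lemma Ord_mono: assumes "x \<in> Ord r" "s \<le> r" shows "x \<in> Ord s"
proof -
  obtain c where c: "x = of_nat p ^ r * c" "\<not> int p dvd snd (quotient_of c)"
    using assms by (auto simp: padic_ideal_def rat_cong_def)
  have "c \<in> Ord 0" using c by (auto simp: padic_ideal_def rat_cong_def)
  then have "of_nat p ^ s * (of_nat p ^ (r - s) * c) \<in> Ord s"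
    by (intro Ord_mult_right Ord_p_power Ord_mult_left[OF Ord_power]) auto
  also have "of_nat p ^ s * (of_nat p ^ (r - s) * c) = x"
    using c assms by (simp flip: mult.assoc power_add)
  finally show ?thesis .
qed

lemma OrdE:
  assumes "x \<in> Ord r"
  obtains c where "x = of_nat p ^ r * c" "c \<in> Ord 0"
  using assms by (auto simp: padic_ideal_def rat_cong_def)

lemma Ord_p_power_mult_cancel: "of_nat p ^ r * c \<in> Ord (r + s) \<Longrightarrow> c \<in> Ord s"
  by (erule OrdE) (auto simp: power_add mult.assoc intro: Ord_mult_right)

lemma Ord_inverse_nat: assumes "\<not> p dvd k" shows "1 / of_nat k \<in> Ord 0"
proof -
  have "k > 0" using assms by (metis dvd_0_right gr0I)
  then show ?thesis
    unfolding mem_Ord_iff using assms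
    by (intro exI[of _ 1] exI[of _ "int k"]) auto
qed

lemma Ord_divide_nat: "x \<in> Ord r \<Longrightarrow> \<not> p dvd k \<Longrightarrow> x / of_nat k \<in> Ord r"
  using Ord_mult_right[OF _ Ord_inverse_nat, of x r k] by simp

end

section \<open>Alternating power sums and Bernoulli numbers\<close>

text \<open>A geometric series of ratio -e^x; its coefficients are alternating power sums divided by
  factorials.\<close>

lemma fps_one_plus_exp_mult_alternating_sum:
  "(1 + fps_exp 1) * (\<Sum>k<n. (- 1) ^ k * fps_exp (of_nat k)) = 1 - (- 1) ^ n * fps_exp (of_nat n :: rat)"
proof (induction n)
  case (Suc n)
  have 1: "fps_exp (1 :: rat) * fps_exp (of_nat n) = fps_exp (of_nat (Suc n))"
    by (simp add: fps_exp_add_mult)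
  have "(1 + e) * (S + s * E) = (1 + e) * S + s * E + s * (e * E)" for e S s E :: "rat fps"
    by (simp add: algebra_simps)
  from this[of "fps_exp 1"] show ?case using Suc by (simp only: sum.lessThan_Suc 1) simp
qed simp

lemma fps_mult_nth_last:
  "fps_nth (f * g) n = fps_nth f n * fps_nth g 0 + (\<Sum>i<n. fps_nth f i * fps_nth g (n - i))"
  by (simp add: fps_mult_nth atLeast0AtMost add.commute flip: lessThan_Suc_atMost)

text \<open>The series 1 / (1 + e^x), half the generating function of the Euler polynomials at
  0.\<close>

definition fps_one_plus_exp_inverse :: "rat fps" where
  "fps_one_plus_exp_inverse = inverse (1 + fps_exp 1)"

lemma fps_one_plus_exp_inverse: "fps_one_plus_exp_inverse * (1 + fps_exp 1) = 1"
  unfolding fps_one_plus_exp_inverse_def by (rule inverse_mult_eq_1) simp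

text \<open>Compare coefficients in x/(e^x + 1) = x/(e^x - 1) - 2x/(e^(2x) - 1). Here
  \<open>G2\<close> is \<open>G\<close> with x replaced by 2x.\<close>

lemma fps_one_plus_exp_inverse_bernoulli:
  "fps_nth fps_one_plus_exp_inverse n = bernoulli (Suc n) * (1 - 2 ^ Suc n) / fact (Suc n)"
proof -
  define G where "G = Abs_fps (\<lambda>n. bernoulli n / fact n)"
  define G2 where "G2 = Abs_fps (\<lambda>n. 2 ^ n * (bernoulli n / fact n))"
  have G: "G * (fps_exp 1 - 1) = fps_X"
    unfolding G_def by (rule bernoulli_generating_function)
  have G2: "G2 * (fps_exp 2 - 1) = 2 * fps_X"
  proof (rule fps_ext)
    fix n
    have "fps_nth (G2 * (fps_exp 2 - 1)) n = (\<Sum>i=0..n. 2 ^ n * (fps_nth G i * fps_nth (fps_exp 1 - 1) (n - i)))"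
      unfolding fps_mult_nth
    proof (intro sum.cong)
      fix i assume "i \<in> {0..n}"
      then have "(2 :: rat) ^ n = 2 ^ i * 2 ^ (n - i)" by (simp flip: power_add)
      then show "fps_nth G2 i * fps_nth (fps_exp 2 - 1) (n - i) =
          2 ^ n * (fps_nth G i * fps_nth (fps_exp 1 - 1) (n - i))"
        by (simp add: G_def G2_def)
    qed simp
    also have "\<dots> = 2 ^ n * fps_nth (G * (fps_exp 1 - 1)) n"
      by (simp add: fps_mult_nth sum_distrib_left)
    also have "\<dots> = fps_nth (2 * fps_X) n"
      unfolding G by (auto simp: fps_numeral_fps_const le_Suc_eq)
    finally show "fps_nth (G2 * (fps_exp 2 - 1)) n = fps_nth (2 * fps_X) n" .
  qed
  have e2: "fps_exp 2 = fps_exp 1 * fps_exp (1 :: rat)"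
    by (simp flip: fps_exp_add_mult)
  have nz: "fps_exp (2 :: rat) - 1 \<noteq> 0"
  proof
    assume "fps_exp (2 :: rat) - 1 = 0"
    then have "fps_nth (fps_exp (2 :: rat) - 1) 1 = 0" by (metis fps_zero_nth)
    then show False by simp
  qed
  have "fps_X * fps_one_plus_exp_inverse * (fps_exp 2 - 1) = (G - G2) * (fps_exp 2 - (1 :: rat fps))"
  proof -
    have "x * c * (e * e - 1) = (g - h) * (e * e - 1)"
      if "g * (e - 1) = x" "h * (e * e - 1) = 2 * x" "c * (1 + e) = 1" for x c e g h :: "rat fps"
    proof -
      have "x * c * (e * e - 1) = x * (e - 1) * (c * (1 + e))" by (simp add: algebra_simps)
      also have "\<dots> = x * (1 + e) - 2 * x" unfolding that(3) by (simp add: algebra_simps)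
      also have "\<dots> = g * (e - 1) * (1 + e) - h * (e * e - 1)" unfolding that(1,2) ..
      finally show ?thesis by (simp add: algebra_simps)
    qed
    from this[OF G G2[unfolded e2] fps_one_plus_exp_inverse] show ?thesis unfolding e2 .
  qed
  then have "fps_X * fps_one_plus_exp_inverse = G - G2" using nz by simp
  then have "fps_nth (fps_X * fps_one_plus_exp_inverse) (Suc n) = fps_nth (G - G2) (Suc n)" by simp
  then show ?thesis by (simp add: G_def G2_def algebra_simps diff_divide_distrib)
qed

context prime_padic
begin

lemma Ord_divide_fact: "x \<in> Ord r \<Longrightarrow> n < p \<Longrightarrow> x / fact n \<in> Ord r"
  using Ord_divide_nat[of x r "fact n"] prime_dvd_fact_iff[OF prime_p] by simp

text \<open>Multiplying by 1 + e^x gives a recursion for the coefficients whose only denominators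
  are 2 and factorials of numbers below \<open>p\<close>.\<close>

lemma Ord_fps_one_plus_exp_inverse:
  assumes "p \<noteq> 2" "n < p"
  shows "fps_nth fps_one_plus_exp_inverse n \<in> Ord 0"
  using assms(2)
proof (induction n rule: less_induct)
  case (less n)
  let ?C = "fps_nth fps_one_plus_exp_inverse"
  have p2: "\<not> p dvd 2" using assms(1) prime_p by (metis primes_dvd_imp_eq two_is_prime_nat)
  have "fps_nth (fps_one_plus_exp_inverse * (1 + fps_exp 1)) n = ?C n * 2 + (\<Sum>i<n. ?C i / fact (n - i))"
    unfolding fps_mult_nth_last by simp
  then have "?C n * 2 = fps_nth 1 n - (\<Sum>i<n. ?C i / fact (n - i))"
    unfolding fps_one_plus_exp_inverse by simp
  also have "\<dots> \<in> Ord 0"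
    using less by (intro Ord_diff Ord_sum Ord_divide_fact) (auto)
  finally have "?C n * 2 / of_nat 2 \<in> Ord 0" by (rule Ord_divide_nat[OF _ p2])
  then show ?case by simp
qed

text \<open>As \<open>p\<close> is odd, the geometric series sums to (1 + e^(px)) / (1 + e^x).
  Modulo \<open>p\<close> only the constant term of e^(px) contributes up to degree
  \<open>n < p\<close>, so the numerator acts as 2.\<close>

lemma alternating_power_sum_cong:
  assumes "p \<noteq> 2" "n < p"
  shows "(\<Sum>k<p. (- 1) ^ k * of_nat k ^ n) - 2 * fact n * fps_nth fps_one_plus_exp_inverse n \<in> Ord 1"
proof -
  let ?C = "fps_nth fps_one_plus_exp_inverse"
  have odd: "odd p" using assms(1) prime_p prime_odd_nat[of p] prime_ge_2_nat[of p] by auto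
  define A :: "rat fps" where "A = (\<Sum>k<p. (- 1) ^ k * fps_exp (of_nat k))"
  have "A = fps_one_plus_exp_inverse * (1 + fps_exp (of_nat p))"
  proof -
    have "(1 + fps_exp 1) * A = 1 + fps_exp (of_nat p)"
      using fps_one_plus_exp_mult_alternating_sum[of p] odd by (simp add: A_def)
    then show ?thesis using fps_one_plus_exp_inverse by (metis mult.assoc mult_1)
  qed
  then have "fps_nth A n = ?C n * 2 + (\<Sum>i<n. ?C i * (of_nat p ^ (n - i) / fact (n - i)))"
    by (simp add: fps_mult_nth_last)
  then have "fps_nth A n - ?C n * 2 = (\<Sum>i<n. ?C i * (of_nat p ^ (n - i) / fact (n - i)))"
    by simp
  also have "\<dots> \<in> Ord 1"
  proof (intro Ord_sum)
    fix i assume i: "i \<in> {..<n}"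
    have "of_nat p ^ (n - i) / fact (n - i) \<in> Ord (n - i)"
      using i assms by (intro Ord_divide_fact) auto
    then have "of_nat p ^ (n - i) / fact (n - i) \<in> Ord 1" by (rule Ord_mono) (use i in auto)
    then show "?C i * (of_nat p ^ (n - i) / fact (n - i)) \<in> Ord 1"
      using i assms by (intro Ord_mult_left Ord_fps_one_plus_exp_inverse) auto
  qed
  finally have "of_nat (fact n) * (fps_nth A n - ?C n * 2) \<in> Ord 1"
    by (intro Ord_mult_left Ord_of_nat)
  moreover have "fps_nth A n = (\<Sum>k<p. (- 1) ^ k * of_nat k ^ n) / fact n"
  proof -
    have "fps_nth ((- 1) ^ k * fps_exp (of_nat k)) n = (- 1) ^ k * of_nat k ^ n / (fact n :: rat)" for k
      by (cases "even k") auto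
    then show ?thesis by (simp add: A_def fps_sum_nth sum_divide_distrib)
  qed
  ultimately show ?thesis by (simp add: algebra_simps)
qed

section \<open>Fermat's little theorem and the alternating sum of inverse cubes\<close>

lemma dvd_power_diff: "int p dvd int k ^ p - int k"
proof (induction k)
  case 0
  then show ?case using prime_gt_0_nat[OF prime_p] by (simp add: power_0_left)
next
  case (Suc k)
  have p1: "p > 1" using prime_p by (rule prime_gt_1_nat)
  have "int (Suc k) ^ p = (\<Sum>i\<le>p. int (p choose i) * int k ^ i)"
    using binomial_ring[of "int k" 1 p] by (simp add: add.commute)
  also have "{..p} = insert 0 (insert p {1..<p})" using p1 by auto
  also have "(\<Sum>i\<in>\<dots>. int (p choose i) * int k ^ i) =
      1 + int k ^ p + (\<Sum>i=1..<p. int (p choose i) * int k ^ i)"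
    using p1 by simp
  finally have "int (Suc k) ^ p - int (Suc k) =
      (int k ^ p - int k) + (\<Sum>i=1..<p. int (p choose i) * int k ^ i)" by simp
  moreover have "int p dvd (\<Sum>i=1..<p. int (p choose i) * int k ^ i)"
  proof (intro dvd_sum dvd_mult2)
    fix i assume "i \<in> {1..<p}"
    then have "p dvd p choose i" by (intro dvd_choose_prime[OF _ _ _ prime_p]) auto
    then show "int p dvd int (p choose i)" by simp
  qed
  ultimately show ?case using Suc by (metis dvd_add)
qed

lemma dvd_power_pred:
  assumes "\<not> p dvd k"
  shows "int p dvd int k ^ (p - 1) - 1"
proof -
  have "int k ^ p = int k * int k ^ (p - 1)"
    using prime_gt_0_nat[OF prime_p] by (simp flip: power_Suc)
  then have "int p dvd int k * (int k ^ (p - 1) - 1)"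
    using dvd_power_diff[of k] by (simp add: algebra_simps)
  then show ?thesis using assms prime_int_p by (simp add: prime_dvd_mult_iff)
qed

lemma Ord_of_int_dvd: "int p dvd a \<Longrightarrow> of_int a \<in> Ord 1"
proof -
  assume "int p dvd a"
  then obtain k where "a = int p * k" by auto
  then show ?thesis using Ord_mult_right[OF Ord_p Ord_of_int[of k]] by simp
qed

lemma of_nat_power_fermat: "\<not> p dvd k \<Longrightarrow> of_nat k ^ (p - 1) - 1 \<in> Ord 1"
  using Ord_of_int_dvd[OF dvd_power_pred, of k] by simp

lemma not_dvd_less: "0 < k \<Longrightarrow> k < p \<Longrightarrow> \<not> p dvd k"
  by (auto dest: dvd_imp_le)

text \<open>By Fermat 1/k^3 \<equiv> k^(p-4) modulo \<open>p\<close>, so the sum is congruent to the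
  power sum \<open>V\<close>, hence to 2f with \<open>f = fact n * ?C n\<close>. The Bernoulli
  formula for \<open>f\<close> and 2^(p-1) \<equiv> 1 give -12 f \<equiv> 3 B_(p-3).\<close>

lemma alternating_cube_sum_bernoulli:
  assumes "p > 3"
  shows "(\<Sum>k=1..p-1. (- 1) ^ k / of_nat k ^ 3) + bernoulli (p - 3) / 2 \<in> Ord 1"
proof -
  let ?C = "fps_nth fps_one_plus_exp_inverse"
  let ?B = "bernoulli (p - 3)"
  define n where "n = p - 4"
  have p: "p = n + 4" using assms by (simp add: n_def)
  define V :: rat where "V = (\<Sum>k<p. (- 1) ^ k * of_nat k ^ n)"
  define s :: rat where "s = (\<Sum>k=1..p-1. (- 1) ^ k / of_nat k ^ 3)"
  have n12: "\<not> p dvd 12"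
  proof
    assume "p dvd 12"
    then have "p dvd 2 ^ 2 * 3" by simp
    then have "p dvd 2 \<or> p dvd 3" using prime_p prime_dvd_mult_iff prime_dvd_power by blast
    then show False using assms by (auto dest: dvd_imp_le)
  qed
  have C0: "?C n \<in> Ord 0" by (rule Ord_fps_one_plus_exp_inverse) (use p in auto)
  have CB: "of_nat (Suc n) * (fact n * ?C n) = ?B * (1 - 2 ^ Suc n)"
  proof -
    have "?C n * fact (Suc n) = bernoulli (Suc n) * (1 - 2 ^ Suc n)"
      using fps_one_plus_exp_inverse_bernoulli[of n] by (simp del: fact_Suc)
    moreover have "p - 3 = Suc n" using p by simp
    ultimately show ?thesis by (simp add: algebra_simps)
  qed
  define f :: rat where "f = fact n * ?C n"
  have f0: "f \<in> Ord 0" unfolding f_def using Ord_mult_left[OF Ord_of_nat[of "fact n"] C0] by simp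
  obtain u where u: "2 ^ (p - 1) - 1 = of_nat p * u" "u \<in> Ord 0"
    using of_nat_power_fermat[of 2] not_dvd_less[of 2] assms by (auto elim: OrdE)
  have "(2 :: rat) ^ (p - 1) = 4 * 2 ^ Suc n" by (simp add: p power_add)
  \<comment> \<open>The Bernoulli formula carries 1 - 2^(p-3); multiplying by 4 turns it into 4 -
    2^(p-1) = 3 - pu.\<close>
  then have 1: "4 * (of_nat p - 3) * f = ?B * (3 - of_nat p * u)"
  proof -
    have "(of_nat p - 3) * f = ?B * (1 - 2 ^ Suc n)" using CB by (simp add: p f_def algebra_simps)
    moreover have "4 * 2 ^ Suc n - 1 = of_nat p * u"
      using u(1) \<open>(2 :: rat) ^ (p - 1) = 4 * 2 ^ Suc n\<close> by simp
    moreover have "4 * a * f = b * (3 - v)" if "a * f = b * (1 - t)" "4 * t - 1 = v" for a b t v :: rat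
      using that by algebra
    ultimately show ?thesis by blast
  qed
  have V: "V - 2 * f \<in> Ord 1"
    using alternating_power_sum_cong[of n] p by (simp add: V_def f_def mult.assoc)
  \<comment> \<open>The exponent \<open>n = p - 4\<close> must be positive, for otherwise the term
    \<open>k = 0\<close> of \<open>V\<close> would be 0^0 = 1.\<close>
  have "p \<noteq> 4" using prime_p by auto
  then have "n > 0" using assms by (simp add: n_def)
  moreover have "{..<p} = insert 0 {1..p-1}" using assms by auto
  ultimately have "V = (\<Sum>k=1..p-1. (- 1) ^ k * of_nat k ^ n)"
    by (simp add: V_def)
  then have "V - s = (\<Sum>k=1..p-1. (- 1) ^ k * (1 / of_nat (k ^ 3) * (of_nat k ^ (p - 1) - 1)))"
  proof -
    have "(- 1) ^ k * of_nat k ^ n - (- 1) ^ k / of_nat k ^ 3 =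
        (- 1) ^ k * (1 / of_nat (k ^ 3) * (of_nat k ^ (p - 1) - 1) :: rat)" if "k \<in> {1..p-1}" for k
    proof -
      have "p - 1 = n + 3" using p by simp
      then have "of_nat k ^ (p - 1) = (of_nat k ^ n * of_nat k ^ 3 :: rat)" by (simp add: power_add)
      then show ?thesis using that by (simp add: field_simps)
    qed
    then show ?thesis
      unfolding \<open>V = (\<Sum>k=1..p-1. (- 1) ^ k * of_nat k ^ n)\<close> s_def sum_subtractf[symmetric]
      by (rule sum.cong[OF refl])
  qed
  also have "\<dots> \<in> Ord 1"
  proof (intro Ord_sum)
    fix k assume k: "k \<in> {1..p-1}"
    then have "0 < k" "k < p" using assms by auto
    then have "\<not> p dvd k" by (rule not_dvd_less)
    then have "1 / of_nat (k ^ 3) * (of_nat k ^ (p - 1) - 1) \<in> Ord 1"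
      using prime_p by (intro Ord_mult_left Ord_inverse_nat of_nat_power_fermat) (auto dest: prime_dvd_power)
    then show "(- 1) ^ k * (1 / of_nat (k ^ 3) * (of_nat k ^ (p - 1) - 1)) \<in> Ord 1"
      by (rule Ord_minus_one_power)
  qed
  finally have Vs: "V - s \<in> Ord 1" .
  \<comment> \<open>This number is -3 modulo \<open>p\<close>, hence a unit, so equation 1 yields
    that B_(p-3) is p-integral.\<close>
  have "\<not> p dvd 2 ^ (p - 1) - 4"
  proof
    assume *: "p dvd 2 ^ (p - 1) - 4"
    have ge: "(2 :: nat) ^ (p - 1) \<ge> 4" using power_increasing[of 2 "p - 1" "2 :: nat"] assms by simp
    have "int p dvd 2 ^ (p - 1) - 1"
      using dvd_power_pred[of 2] not_dvd_less[of 2] assms by simp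
    moreover have "int p dvd 2 ^ (p - 1) - 4"
      using * ge by (metis of_nat_dvd_iff of_nat_diff of_nat_power of_nat_numeral)
    ultimately have "int p dvd (2 ^ (p - 1) - 1) - (2 ^ (p - 1) - 4)" by (rule dvd_diff)
    then have "int p dvd int 3" by simp
    then have "p dvd 3" by (simp only: of_nat_dvd_iff)
    then show False using assms by (auto dest: dvd_imp_le)
  qed
  moreover have "(2 :: nat) ^ (p - 1) \<ge> 4" using power_increasing[of 2 "p - 1" "2 :: nat"] assms by simp
  then have "of_nat (2 ^ (p - 1) - 4) = of_nat p * u - 3" using u(1) by (simp add: of_nat_diff)
  then have "?B * of_nat (2 ^ (p - 1) - 4) = - (4 * (of_nat p - 3) * f)"
    unfolding 1 by (simp only:) (simp only: algebra_simps)
  moreover have "4 * (of_nat p - 3) * f \<in> Ord 0"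
    using f0 by (intro Ord_mult_left Ord_diff) auto
  ultimately have "?B * of_nat (2 ^ (p - 1) - 4) / of_nat (2 ^ (p - 1) - 4) \<in> Ord 0"
    by (intro Ord_divide_nat) (auto intro: Ord_uminus)
  moreover have "2 ^ (p - 1) - 4 \<noteq> (0 :: nat)" using \<open>\<not> p dvd 2 ^ (p - 1) - 4\<close> by (metis dvd_0_right)
  ultimately have B0: "?B \<in> Ord 0" by (simp del: of_nat_diff)
  \<comment> \<open>The error term \<open>?X\<close> equals 2f + B/2, as found by solving 1 for
    12f.\<close>
  have "of_nat p * (8 * f + 2 * ?B * u) / of_nat 12 \<in> Ord 1" (is "?X \<in> _")
    by (intro Ord_divide_nat[OF _ n12] Ord_mult_right[OF Ord_p] Ord_add Ord_mult_left) (use f0 B0 u in auto)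
  then have "(V - 2 * f) - (V - s) + ?X \<in> Ord 1" by (intro Ord_add Ord_diff V Vs)
  also have "(V - 2 * f) - (V - s) + ?X = s + ?B / 2"
    using 1 by (simp add: field_simps)
  finally show ?thesis by (simp only: s_def)
qed

end

section \<open>Harmonic sums\<close>

lemma sum_reflect: "(\<Sum>k=1..p-1. f k) = (\<Sum>k=1..p-1. f (p - k))" for p :: nat
  by (rule sum.reindex_bij_witness[of _ "\<lambda>k. p - k" "\<lambda>k. p - k"]) auto

lemma sum_fold_half:
  "(\<Sum>k=1..2*h. f k) = (\<Sum>k=1..h. f k + f (2 * h + 1 - k))" for h :: nat and f :: "nat \<Rightarrow> 'a :: comm_monoid_add"
proof -
  have "{1..2*h} = {1..h} \<union> {h+1..2*h}" "{1..h} \<inter> {h+1..2*h} = {}" by auto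
  then have "(\<Sum>k=1..2*h. f k) = (\<Sum>k=1..h. f k) + (\<Sum>k=h+1..2*h. f k)"
    by (simp add: sum.union_disjoint)
  also have "(\<Sum>k=h+1..2*h. f k) = (\<Sum>k=1..h. f (2 * h + 1 - k))"
    by (rule sum.reindex_bij_witness[of _ "\<lambda>k. 2 * h + 1 - k" "\<lambda>k. 2 * h + 1 - k"]) auto
  finally show ?thesis by (simp add: sum.distrib)
qed

lemma sum_even_terms:
  "(\<Sum>k=1..2*h. f k) + (\<Sum>k=1..2*h. (- 1) ^ k * f k) = 2 * (\<Sum>k=1..h. f (2 * k))"
  for h :: nat and f :: "nat \<Rightarrow> 'a :: comm_ring_1"
  by (induction h) (simp_all add: algebra_simps)

text \<open>Pairing the terms \<open>2 i - 1\<close> and \<open>2 i\<close> leaves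
  \<open>f (2 i)\<close>, and \<open>sum_even_terms\<close> applies.\<close>

lemma alternating_sum_partial_sums:
  "2 * (\<Sum>k=1..2*h. (- 1) ^ k * (\<Sum>i=1..k. f i)) = (\<Sum>k=1..2*h. f k) + (\<Sum>k=1..2*h. (- 1) ^ k * f k)"
  for h :: nat and f :: "nat \<Rightarrow> 'a :: comm_ring_1"
  by (induction h) (simp_all add: algebra_simps)

lemma alternating_sum_telescope:
  "(\<Sum>k=1..n. (- 1) ^ k * (f k + f (Suc k))) = (- 1) ^ n * f (Suc n) - f 1"
  for f :: "nat \<Rightarrow> 'a :: comm_ring_1"
  by (induction n) (simp_all add: algebra_simps)

section \<open>A fixed prime \<open>p > 3\<close>: reflection, inverses and the sums to be
  evaluated\<close>

locale large_prime_padic = prime_padic +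
  assumes p_gt_3: "p > 3"
begin

lemma odd_p: "odd p"
  using prime_p p_gt_3 prime_odd_nat[of p] by simp

lemma p_eq: "p = 2 * (p div 2) + 1" "p - 1 = 2 * (p div 2)"
  using odd_p by presburger+

lemma not_dvd_less_double: assumes "0 < m" "m < 2 * p" "m \<noteq> p" shows "\<not> p dvd m"
proof
  assume "p dvd m"
  then obtain c where "m = p * c" by auto
  then show False using assms by (cases c; cases "c - 1") auto
qed

lemma not_dvd_2: "\<not> p dvd 2" and not_dvd_3: "\<not> p dvd 3" and not_dvd_pred: "\<not> p dvd p - 1"
  using p_gt_3 not_dvd_less[of 2] not_dvd_less[of 3] not_dvd_less[of "p - 1"] by auto

lemma Ord_halve: "2 * x \<in> Ord r \<Longrightarrow> x \<in> Ord r"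
  using Ord_divide_nat[OF _ not_dvd_2, of "2 * x" r] by simp

lemma minus_one_power_reflect: "k \<le> p \<Longrightarrow> (- 1) ^ (p - k) = - ((- 1) ^ k :: rat)"
  using odd_p by (cases "even k") auto

abbreviation P :: rat where "P \<equiv> of_nat p"

definition shift_inv :: "nat \<Rightarrow> rat" where "shift_inv k = 1 / (P + of_nat k)"

definition power_harm :: "nat \<Rightarrow> rat" where
  "power_harm r = (\<Sum>k=1..p-1. (1 / of_nat k) ^ r)"

definition alt_power_harm :: "nat \<Rightarrow> rat" where
  "alt_power_harm r = (\<Sum>k=1..p-1. (- 1) ^ k * (1 / of_nat k) ^ r)"

definition square_harm :: "nat \<Rightarrow> rat" where
  "square_harm n = (\<Sum>k=1..n. (1 / of_nat k) ^ 2)"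

definition square_prod :: "nat \<Rightarrow> rat" where
  "square_prod n = (\<Prod>k=1..n. 1 - P ^ 2 * (1 / of_nat k) ^ 2)"

lemma Ord_P2 [simp]: "P ^ 2 \<in> Ord 2" by (rule Ord_p_power)

lemma not_dvd_range: "k \<in> {1..p-1} \<Longrightarrow> \<not> p dvd k"
  by (rule not_dvd_less) auto

lemma Ord_inv: "k \<in> {1..p-1} \<Longrightarrow> 1 / of_nat k \<in> Ord 0"
  by (rule Ord_inverse_nat) (rule not_dvd_range)

lemma Ord_inv_reflect: "k \<in> {1..p-1} \<Longrightarrow> 1 / of_nat (p - k) \<in> Ord 0"
  by (rule Ord_inv) auto

lemma Ord_shift_inv: "k \<in> {1..p-1} \<Longrightarrow> shift_inv k \<in> Ord 0"
  using Ord_inverse_nat[of "p + k"] not_dvd_range[of k] by (simp add: shift_inv_def)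

lemma Ord_shift_inv_reflect: "k \<in> {1..p-1} \<Longrightarrow> shift_inv (p - k) \<in> Ord 0"
  by (rule Ord_shift_inv) auto

lemma inv_mult: "k \<in> {1..p-1} \<Longrightarrow> (1 / of_nat k) * of_nat k = (1 :: rat)"
  by simp

lemma inv_reflect_mult: "k \<in> {1..p-1} \<Longrightarrow> (1 / of_nat (p - k)) * (P - of_nat k) = (1 :: rat)"
  by (auto simp: of_nat_diff field_simps)

lemma shift_inv_mult: "shift_inv k * (P + of_nat k) = 1"
  unfolding shift_inv_def by (simp flip: of_nat_add)

lemma shift_inv_reflect_mult: "k \<in> {1..p-1} \<Longrightarrow> shift_inv (p - k) * (2 * P - of_nat k) = 1"
proof -
  assume "k \<in> {1..p-1}"
  then have "k \<le> p" by auto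
  then have "rat_of_nat (p - k) = P - of_nat k" by (rule of_nat_diff)
  then show ?thesis using shift_inv_mult[of "p - k"] by (simp add: algebra_simps)
qed

lemmas Ord_intros = Ord_add Ord_diff Ord_uminus Ord_mult_left Ord_power Ord_inv Ord_inv_reflect
  Ord_shift_inv Ord_shift_inv_reflect Ord_numeral Ord_1 Ord_of_nat

section \<open>Harmonic sums modulo powers of \<open>p\<close>\<close>

lemma Ord_alt_power_harm: "alt_power_harm r \<in> Ord 0"
  unfolding alt_power_harm_def by (intro Ord_sum Ord_minus_one_power Ord_intros) auto

lemma Ord_square_harm: "n < p \<Longrightarrow> square_harm n \<in> Ord 0"
  unfolding square_harm_def by (intro Ord_sum Ord_intros) auto

lemma inv_reflect_square:
  assumes "k \<in> {1..p-1}"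
  shows "(1 / of_nat k) ^ 2 + 2 * P * (1 / of_nat k) ^ 3 - (1 / of_nat (p - k)) ^ 2 \<in> Ord 2"
proof -
  define u v where "u = 1 / rat_of_nat k" and "v = 1 / rat_of_nat (p - k)"
  have "u * of_nat k = 1" "v * (P - of_nat k) = 1"
    using inv_mult[OF assms] inv_reflect_mult[OF assms] by (simp_all only: u_def v_def)
  \<comment> \<open>Expansion of 1/(p - k)^2 in \<open>p\<close> to first order, with the exact
    remainder on the right. The relations defining \<open>u\<close> and \<open>v\<close> make it a
    polynomial identity; the later expansions are proved the same way.\<close>
  then have "u ^ 2 + 2 * P * u ^ 3 - v ^ 2 = P ^ 2 * ((2 * P - 3 * of_nat k) * u ^ 3 * v ^ 2)"
    by algebra
  also have "\<dots> \<in> Ord 2"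
    unfolding u_def v_def by (intro Ord_mult_right[OF Ord_P2] Ord_intros assms)
  finally show ?thesis by (simp only: u_def v_def)
qed

text \<open>The reflection k -> p - k changes the sign of (-1)^k because \<open>p\<close> is odd;
  averaging the sum with its reflection leaves only the first-order term of
  \<open>inv_reflect_square\<close>.\<close>

lemma alt_power_harm_2: "alt_power_harm 2 + P * alt_power_harm 3 \<in> Ord 2"
proof (rule Ord_halve)
  have "alt_power_harm 2 = (\<Sum>k=1..p-1. - ((- 1) ^ k * (1 / of_nat (p - k)) ^ 2))"
    unfolding alt_power_harm_def by (subst sum_reflect) (auto intro!: sum.cong simp: minus_one_power_reflect)
  then have "2 * (alt_power_harm 2 + P * alt_power_harm 3) = (\<Sum>k=1..p-1. (- 1) ^ k *
      ((1 / of_nat k) ^ 2 + 2 * P * (1 / of_nat k) ^ 3 - (1 / of_nat (p - k)) ^ 2))"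
    unfolding mult_2 distrib_left
    by (simp add: alt_power_harm_def sum_distrib_left sum_negf sum.distrib sum_subtractf algebra_simps)
  also have "\<dots> \<in> Ord 2" by (intro Ord_sum Ord_minus_one_power inv_reflect_square)
  finally show "2 * (alt_power_harm 2 + P * alt_power_harm 3) \<in> Ord 2" .
qed

lemma inv_add_reflect:
  assumes "k \<in> {1..p-1}"
  shows "1 / rat_of_nat k + 1 / of_nat (p - k) = P * ((1 / of_nat k) * (1 / of_nat (p - k)))"
proof -
  define u v where "u = 1 / rat_of_nat k" and "v = 1 / rat_of_nat (p - k)"
  have "u * of_nat k = 1" "v * (P - of_nat k) = 1"
    using inv_mult[OF assms] inv_reflect_mult[OF assms] by (simp_all only: u_def v_def)
  then have "u + v = P * (u * v)" by algebra
  then show ?thesis by (simp only: u_def v_def)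
qed

lemma power_harm_3: "power_harm 3 \<in> Ord 1"
proof (rule Ord_halve)
  have "power_harm 3 = (\<Sum>k=1..p-1. (1 / of_nat (p - k)) ^ 3)"
    unfolding power_harm_def by (subst sum_reflect) simp
  then have "2 * power_harm 3 = (\<Sum>k=1..p-1. (1 / of_nat k) ^ 3 + (1 / of_nat (p - k)) ^ 3)"
    unfolding mult_2 by (simp only: sum.distrib) (simp only: power_harm_def)
  also have "\<dots> \<in> Ord 1"
  proof (intro Ord_sum)
    fix k assume k: "k \<in> {1..p-1}"
    define u v where "u = 1 / rat_of_nat k" and "v = 1 / rat_of_nat (p - k)"
    have "u + v = P * (u * v)" using inv_add_reflect[OF k] by (simp only: u_def v_def)
    then have "u ^ 3 + v ^ 3 = P * (u * v * (u ^ 2 - u * v + v ^ 2))" by algebra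
    also have "\<dots> \<in> Ord 1"
      unfolding u_def v_def by (intro Ord_mult_right[OF Ord_p] Ord_intros k)
    finally show "(1 / of_nat k) ^ 3 + (1 / of_nat (p - k)) ^ 3 \<in> Ord 1" by (simp only: u_def v_def)
  qed
  finally show "2 * power_harm 3 \<in> Ord 1" .
qed

text \<open>The half sums \<open>Q r\<close> arise in two ways: from the even terms, giving
  \<open>power_harm r + alt_power_harm r\<close>, and by folding the upper half of
  \<open>power_harm 2\<close> onto the lower half. Comparing the two determines
  \<open>3 * power_harm 2\<close>.\<close>

lemma power_harm_2: "3 * power_harm 2 + 4 * P * alt_power_harm 3 \<in> Ord 2"
proof -
  define h where "h = p div 2"
  have p: "p - 1 = 2 * h" "2 * h + 1 = p" using p_eq by (simp_all add: h_def)
  define Q where "Q r = (\<Sum>k=1..h. (1 / rat_of_nat k) ^ r)" for r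
  have even: "power_harm r + alt_power_harm r = 2 * (1 / 2) ^ r * Q r" for r
    unfolding power_harm_def alt_power_harm_def p sum_even_terms Q_def
    by (simp add: sum_distrib_left power_divide power_mult_distrib)
  have "2 * Q 2 + 2 * P * Q 3 - power_harm 2 =
      (\<Sum>k=1..h. (1 / of_nat k) ^ 2 + 2 * P * (1 / of_nat k) ^ 3 - (1 / of_nat (p - k)) ^ 2)"
    unfolding power_harm_def p sum_fold_half Q_def
    by (simp add: sum_distrib_left sum.distrib sum_subtractf)
  also have "\<dots> \<in> Ord 2"
    by (intro Ord_sum inv_reflect_square) (use p in auto)
  finally have "2 * Q 2 + 2 * P * Q 3 - power_harm 2 \<in> Ord 2" .
  moreover have "P * power_harm 3 \<in> Ord 2"
    by (rule Ord_mult_eq[OF Ord_p power_harm_3]) simp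
  ultimately have "(2 * Q 2 + 2 * P * Q 3 - power_harm 2) - 8 * (P * power_harm 3)
      - 4 * (alt_power_harm 2 + P * alt_power_harm 3) \<in> Ord 2"
    using Ord_diff[OF Ord_diff[OF _ Ord_mult_left[OF Ord_numeral]]
        Ord_mult_left[OF Ord_numeral alt_power_harm_2]] by blast
  also have "Q 2 = 2 * (power_harm 2 + alt_power_harm 2)" using even[of 2] by (simp add: power_divide)
  also have "Q 3 = 4 * (power_harm 3 + alt_power_harm 3)" using even[of 3] by (simp add: power_divide)
  finally show ?thesis by (simp add: algebra_simps)
qed

lemma power_harm_2_Ord: "power_harm 2 \<in> Ord 1"
proof -
  have "4 * P * alt_power_harm 3 \<in> Ord 1"
    using Ord_mult_right[OF Ord_p, of "4 * alt_power_harm 3"] Ord_alt_power_harm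
    by (simp add: Ord_mult_left algebra_simps)
  then have "(3 * power_harm 2 + 4 * P * alt_power_harm 3) - 4 * P * alt_power_harm 3 \<in> Ord 1"
    using power_harm_2 by (intro Ord_diff) (auto intro: Ord_mono)
  then show ?thesis using Ord_divide_nat[OF _ not_dvd_3, of "3 * power_harm 2" 1] by simp
qed

section \<open>Sums of 1/(p + k) and its square\<close>

lemma alt_shift_sum:
  "(\<Sum>k=1..p-1. (- 1) ^ k * shift_inv k) - alt_power_harm 1 - 2 * P ^ 2 * alt_power_harm 3 \<in> Ord 3"
proof -
  have "(\<Sum>k=1..p-1. (- 1) ^ k * (shift_inv k - 1 / of_nat k + P * (1 / of_nat k) ^ 2 - P ^ 2 * (1 / of_nat k) ^ 3)) \<in> Ord 3"
  proof (intro Ord_sum Ord_minus_one_power)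
    fix k assume k: "k \<in> {1..p-1}"
    define u w where "u = 1 / rat_of_nat k" and "w = shift_inv k"
    have "u * of_nat k = 1" "w * (P + of_nat k) = 1"
      using inv_mult[OF k] shift_inv_mult[of k] by (simp_all only: u_def w_def)
    then have "w - u + P * u ^ 2 - P ^ 2 * u ^ 3 = P ^ 3 * (- (u ^ 3 * w))" by algebra
    also have "\<dots> \<in> Ord 3"
      unfolding u_def w_def by (intro Ord_mult_right[OF Ord_p_power] Ord_intros k)
    finally show "shift_inv k - 1 / of_nat k + P * (1 / of_nat k) ^ 2 - P ^ 2 * (1 / of_nat k) ^ 3 \<in> Ord 3"
      by (simp only: u_def w_def)
  qed
  \<comment> \<open>The expansion gives a1 - p a2 + p^2 a3, where ar is
    \<open>alt_power_harm r\<close>; replacing a2 by -p a3 doubles the last coefficient.\<close>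
  moreover have "P * (alt_power_harm 2 + P * alt_power_harm 3) \<in> Ord 3"
    by (rule Ord_mult_eq[OF Ord_p alt_power_harm_2]) simp
  ultimately have "(\<Sum>k=1..p-1. (- 1) ^ k * (shift_inv k - 1 / of_nat k + P * (1 / of_nat k) ^ 2 - P ^ 2 * (1 / of_nat k) ^ 3))
      - P * (alt_power_harm 2 + P * alt_power_harm 3) \<in> Ord 3" by (rule Ord_diff)
  also have "(\<Sum>k=1..p-1. (- 1) ^ k * (shift_inv k - 1 / of_nat k + P * (1 / of_nat k) ^ 2 - P ^ 2 * (1 / of_nat k) ^ 3))
     = (\<Sum>k=1..p-1. (- 1) ^ k * shift_inv k) - alt_power_harm 1 + P * alt_power_harm 2 - P ^ 2 * alt_power_harm 3"
    by (simp add: alt_power_harm_def sum_distrib_left sum.distrib sum_subtractf algebra_simps)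
  finally show ?thesis by (simp add: algebra_simps power2_eq_square)
qed

lemma alt_shift_square_sum:
  "(\<Sum>k=1..p-1. (- 1) ^ k * shift_inv k ^ 2) + 3 * P * alt_power_harm 3 \<in> Ord 2"
proof -
  have "(\<Sum>k=1..p-1. (- 1) ^ k * (shift_inv k ^ 2 - (1 / of_nat k) ^ 2 + 2 * P * (1 / of_nat k) ^ 3)) \<in> Ord 2"
  proof (intro Ord_sum Ord_minus_one_power)
    fix k assume k: "k \<in> {1..p-1}"
    define u w where "u = 1 / rat_of_nat k" and "w = shift_inv k"
    have "u * of_nat k = 1" "w * (P + of_nat k) = 1"
      using inv_mult[OF k] shift_inv_mult[of k] by (simp_all only: u_def w_def)
    then have "w ^ 2 - u ^ 2 + 2 * P * u ^ 3 = P ^ 2 * ((3 * of_nat k + 2 * P) * u ^ 3 * w ^ 2)" by algebra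
    also have "\<dots> \<in> Ord 2"
      unfolding u_def w_def by (intro Ord_mult_right[OF Ord_P2] Ord_intros k)
    finally show "shift_inv k ^ 2 - (1 / of_nat k) ^ 2 + 2 * P * (1 / of_nat k) ^ 3 \<in> Ord 2"
      by (simp only: u_def w_def)
  qed
  from Ord_add[OF this alt_power_harm_2]
  have "(\<Sum>k=1..p-1. (- 1) ^ k * (shift_inv k ^ 2 - (1 / of_nat k) ^ 2 + 2 * P * (1 / of_nat k) ^ 3))
      + (alt_power_harm 2 + P * alt_power_harm 3) \<in> Ord 2" .
  also have "(\<Sum>k=1..p-1. (- 1) ^ k * (shift_inv k ^ 2 - (1 / of_nat k) ^ 2 + 2 * P * (1 / of_nat k) ^ 3))
     = (\<Sum>k=1..p-1. (- 1) ^ k * shift_inv k ^ 2) - alt_power_harm 2 + 2 * P * alt_power_harm 3"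
    by (simp add: alt_power_harm_def sum_distrib_left sum.distrib sum_subtractf algebra_simps)
  finally show ?thesis by (simp add: algebra_simps)
qed

text \<open>The denominators p + k and 2p - k add up to 3p, the origin of the factors 3
  below.\<close>

lemma shift_inv_add_reflect:
  assumes "k \<in> {1..p-1}"
  shows "shift_inv k + shift_inv (p - k) = 3 * P * (shift_inv k * shift_inv (p - k))"
  using shift_inv_mult[of k] shift_inv_reflect_mult[OF assms] by algebra

lemma shift_inv_reflect_sum:
  "2 * (\<Sum>k=1..p-1. shift_inv k) = 3 * P * (\<Sum>k=1..p-1. shift_inv k * shift_inv (p - k))"
proof -
  have "2 * (\<Sum>k=1..p-1. shift_inv k) = (\<Sum>k=1..p-1. shift_inv k + shift_inv (p - k))"
    unfolding mult_2 sum.distrib using sum_reflect[of shift_inv p] by simp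
  also have "\<dots> = (\<Sum>k=1..p-1. 3 * P * (shift_inv k * shift_inv (p - k)))"
    by (intro sum.cong shift_inv_add_reflect) auto
  finally show ?thesis by (simp add: sum_distrib_left)
qed

text \<open>The reflected product is -1/k^2 - p/k^3 modulo p^2, and the cubes sum to 0 modulo
  \<open>p\<close>; the extra factor \<open>p\<close> of \<open>shift_inv_reflect_sum\<close> lifts
  this to p^3.\<close>

lemma shift_sum: "2 * (\<Sum>k=1..p-1. shift_inv k) + 3 * P * power_harm 2 \<in> Ord 3"
proof -
  have "(\<Sum>k=1..p-1. shift_inv k * shift_inv (p - k) + (1 / of_nat k) ^ 2 + P * (1 / of_nat k) ^ 3) \<in> Ord 2"
  proof (intro Ord_sum)
    fix k assume k: "k \<in> {1..p-1}"
    define u w v where "u = 1 / rat_of_nat k" and "w = shift_inv k" and "v = shift_inv (p - k)"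
    have "u * of_nat k = 1" "w * (P + of_nat k) = 1" "v * (2 * P - of_nat k) = 1"
      using inv_mult[OF k] shift_inv_mult[of k] shift_inv_reflect_mult[OF k]
      by (simp_all only: u_def w_def v_def)
    then have "w * v + u ^ 2 + P * u ^ 3 = P ^ 2 * ((3 * of_nat k + 2 * P) * u ^ 3 * (w * v))" by algebra
    also have "\<dots> \<in> Ord 2"
      unfolding u_def w_def v_def by (intro Ord_mult_right[OF Ord_P2] Ord_intros k)
    finally show "shift_inv k * shift_inv (p - k) + (1 / of_nat k) ^ 2 + P * (1 / of_nat k) ^ 3 \<in> Ord 2"
      by (simp only: u_def w_def v_def)
  qed
  moreover have "P * power_harm 3 \<in> Ord 2"
    by (rule Ord_mult_eq[OF Ord_p power_harm_3]) simp
  ultimately have "(\<Sum>k=1..p-1. shift_inv k * shift_inv (p - k) + (1 / of_nat k) ^ 2 + P * (1 / of_nat k) ^ 3)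
      - P * power_harm 3 \<in> Ord 2" by (rule Ord_diff)
  also have "(\<Sum>k=1..p-1. shift_inv k * shift_inv (p - k) + (1 / of_nat k) ^ 2 + P * (1 / of_nat k) ^ 3)
      - P * power_harm 3 = (\<Sum>k=1..p-1. shift_inv k * shift_inv (p - k)) + power_harm 2"
    by (simp add: power_harm_def sum_distrib_left sum.distrib)
  finally have "(\<Sum>k=1..p-1. shift_inv k * shift_inv (p - k)) + power_harm 2 \<in> Ord 2" .
  then have "P * ((\<Sum>k=1..p-1. shift_inv k * shift_inv (p - k)) + power_harm 2) \<in> Ord 3"
    by (rule Ord_mult_eq[OF Ord_p]) simp
  then have "3 * (P * ((\<Sum>k=1..p-1. shift_inv k * shift_inv (p - k)) + power_harm 2)) \<in> Ord 3"
    by (rule Ord_mult_left[OF Ord_numeral])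
  then show ?thesis unfolding shift_inv_reflect_sum by (simp add: algebra_simps)
qed

section \<open>The products of 1 - p^2 / i^2\<close>

lemma square_prod_cong:
  assumes "n < p"
  shows "square_prod n - 1 + P ^ 2 * square_harm n \<in> Ord 4" "square_prod n - 1 \<in> Ord 2"
proof -
  \<comment> \<open>Stated with the finer congruence as premise, so that it can serve inside the
    induction proving that congruence.\<close>
  have 2: "square_prod n - 1 \<in> Ord 2"
    if "square_prod n - 1 + P ^ 2 * square_harm n \<in> Ord 4" "n < p" for n
  proof -
    have "(square_prod n - 1 + P ^ 2 * square_harm n) - P ^ 2 * square_harm n \<in> Ord 2"
      using that by (intro Ord_diff Ord_mult_right[OF Ord_P2] Ord_square_harm) (auto intro: Ord_mono)
    then show ?thesis by simp
  qed
  show "square_prod n - 1 + P ^ 2 * square_harm n \<in> Ord 4" using assms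
  proof (induction n)
    case (Suc n)
    define u where "u = 1 / rat_of_nat (Suc n)"
    have "u \<in> Ord 0" unfolding u_def using Suc by (intro Ord_inv) auto
    then have "(square_prod n - 1) * (P ^ 2 * u ^ 2) \<in> Ord (2 + 2)"
      using Suc 2[of n] by (intro Ord_mult Ord_mult_right[OF Ord_P2] Ord_power) auto
    then have "(square_prod n - 1 + P ^ 2 * square_harm n) - (square_prod n - 1) * (P ^ 2 * u ^ 2) \<in> Ord 4"
      using Suc by (intro Ord_diff) auto
    moreover have 1: "square_prod (Suc n) = square_prod n * (1 - P ^ 2 * u ^ 2)"
      and 2: "square_harm (Suc n) = square_harm n + u ^ 2"
      by (simp_all add: square_prod_def square_harm_def u_def)
    have "square_prod (Suc n) - 1 + P ^ 2 * square_harm (Suc n) =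
        (square_prod n - 1 + P ^ 2 * square_harm n) - (square_prod n - 1) * (P ^ 2 * u ^ 2)"
      unfolding 1 2 by algebra
    ultimately show ?case by (simp only:)
  qed (simp add: square_prod_def square_harm_def)
  then show "square_prod n - 1 \<in> Ord 2" using 2 assms by blast
qed

lemma Ord_square_prod: "n < p \<Longrightarrow> square_prod n \<in> Ord 0"
  using Ord_add[OF Ord_mono[OF square_prod_cong(2)] Ord_1] by simp

text \<open>Increasing \<open>n\<close> moves one inverse square from the second sum to the first up
  to reflection, which costs a multiple of \<open>p\<close>; the case \<open>n = 0\<close> is
  \<open>power_harm_2_Ord\<close>.\<close>

lemma square_harm_reflect: "n < p \<Longrightarrow> square_harm n + square_harm (p - 1 - n) \<in> Ord 1"
proof (induction n)
  case 0
  then show ?case using power_harm_2_Ord by (simp add: square_harm_def power_harm_def)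
next
  case (Suc n)
  have k: "Suc n \<in> {1..p-1}" using Suc by auto
  define u v where "u = 1 / rat_of_nat (Suc n)" and "v = 1 / rat_of_nat (p - Suc n)"
  have "u + v = P * (u * v)" using inv_add_reflect[OF k] by (simp only: u_def v_def)
  then have "u ^ 2 - v ^ 2 = P * (u * v * (u - v))" by algebra
  also have "\<dots> \<in> Ord 1"
    unfolding u_def v_def by (intro Ord_mult_right[OF Ord_p] Ord_intros k)
  finally have "u ^ 2 - v ^ 2 \<in> Ord 1" .
  moreover have "square_harm n + square_harm (p - 1 - n) \<in> Ord 1" using Suc by simp
  ultimately have "(square_harm n + square_harm (p - 1 - n)) + (u ^ 2 - v ^ 2) \<in> Ord 1"
    by (intro Ord_add[of "square_harm n + square_harm (p - 1 - n)"])
  moreover have "square_harm (Suc n) = square_harm n + u ^ 2"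
    by (simp add: square_harm_def u_def)
  moreover have "p - 1 - n = Suc (p - 1 - Suc n)" "p - Suc n = Suc (p - 1 - Suc n)" using Suc by auto
  then have "square_harm (p - 1 - n) = square_harm (p - 1 - Suc n) + v ^ 2"
    by (simp add: square_harm_def v_def)
  ultimately show ?case by (simp add: algebra_simps)
qed

text \<open>The terms of order p^2 cancel modulo p^3 by \<open>square_harm_reflect\<close>. The
  extra power of \<open>p\<close> is needed later, where a denominator equals
  \<open>p\<close>.\<close>

lemma square_prod_reflect:
  assumes "n < p"
  shows "square_prod n * square_prod (p - 1 - n) - 1 \<in> Ord 3"
proof -
  define m where "m = p - 1 - n"
  have m: "m < p" using p_gt_3 by (simp add: m_def)
  have "P ^ 2 * (square_harm n + square_harm m) \<in> Ord 3"
    unfolding m_def by (rule Ord_mult_eq[OF Ord_P2 square_harm_reflect[OF assms]]) simp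
  moreover have "(square_prod n - 1) * (square_prod m - 1) \<in> Ord 3"
    using Ord_mono[OF Ord_mult[OF square_prod_cong(2)[OF assms] square_prod_cong(2)[OF m]]] by simp
  moreover have "square_prod n - 1 + P ^ 2 * square_harm n \<in> Ord 3"
    "square_prod m - 1 + P ^ 2 * square_harm m \<in> Ord 3"
    using Ord_mono[OF square_prod_cong(1)[OF assms], of 3] Ord_mono[OF square_prod_cong(1)[OF m], of 3]
    by simp_all
  ultimately have "(square_prod n - 1) * (square_prod m - 1) + (square_prod n - 1 + P ^ 2 * square_harm n)
      + (square_prod m - 1 + P ^ 2 * square_harm m) - P ^ 2 * (square_harm n + square_harm m) \<in> Ord 3"
    using Ord_diff[OF Ord_add[OF Ord_add]] by blast
  then have "square_prod n * square_prod m - 1 \<in> Ord 3" by (simp add: algebra_simps)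
  then show ?thesis by (simp only: m_def)
qed

lemma alt_square_prod_sum:
  "2 * (\<Sum>k=1..p-1. (- 1) ^ k * square_prod k) + P ^ 2 * (power_harm 2 + alt_power_harm 2) \<in> Ord 4"
proof -
  have 1: "(\<Sum>k=1..p-1. (- 1) ^ k) = (0 :: rat)"
    \<comment> \<open>The constant 1/2 makes \<open>f k + f (Suc k)\<close> equal to 1.\<close>
    using alternating_sum_telescope[of "\<lambda>_. 1 / 2 :: rat" "p - 1"] odd_p by simp
  have 2: "2 * (\<Sum>k=1..p-1. (- 1) ^ k * square_harm k) = power_harm 2 + alt_power_harm 2"
    unfolding square_harm_def power_harm_def alt_power_harm_def p_eq(2)
    by (rule alternating_sum_partial_sums)
  have "2 * (\<Sum>k=1..p-1. (- 1) ^ k * (square_prod k - 1 + P ^ 2 * square_harm k)) \<in> Ord 4"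
    by (intro Ord_sum Ord_minus_one_power Ord_mult_left square_prod_cong) auto
  also have "(\<Sum>k=1..p-1. (- 1) ^ k * (square_prod k - 1 + P ^ 2 * square_harm k)) =
      (\<Sum>k=1..p-1. (- 1) ^ k * square_prod k) - (\<Sum>k=1..p-1. (- 1) ^ k)
        + P ^ 2 * (\<Sum>k=1..p-1. (- 1) ^ k * square_harm k)"
    by (simp add: sum.distrib sum_subtractf sum_distrib_left algebra_simps)
  finally show ?thesis unfolding 1 2[symmetric] by (simp add: algebra_simps)
qed

text \<open>Modulo \<open>p\<close>, reflection turns \<open>square_harm k\<close> into
  \<open>- square_harm (k - 1)\<close> and 1/k into -1/k. The sum and its reflection thus differ
  only by the last term of \<open>square_harm k\<close>, which produces the cube.\<close>

lemma alt_square_harm_sum: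
  "2 * (\<Sum>k=1..p-1. (- 1) ^ k * (square_harm k * (1 / of_nat k))) - alt_power_harm 3 \<in> Ord 1"
proof -
  define Z where "Z = (\<Sum>k=1..p-1. (- 1) ^ k * (square_harm k * (1 / of_nat k)))"
  have "Z = (\<Sum>k=1..p-1. - ((- 1) ^ k * (square_harm (p - k) * (1 / of_nat (p - k)))))"
    unfolding Z_def by (subst sum_reflect) (auto intro!: sum.cong simp: minus_one_power_reflect)
  then have "2 * Z - alt_power_harm 3 = (\<Sum>k=1..p-1. (- 1) ^ k *
      (square_harm k * (1 / of_nat k) - square_harm (p - k) * (1 / of_nat (p - k)) - (1 / of_nat k) ^ 3))"
    unfolding mult_2 alt_power_harm_def
    by (simp add: sum_negf sum_subtractf right_diff_distrib) (simp add: Z_def)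
  also have "\<dots> \<in> Ord 1"
  proof (intro Ord_sum Ord_minus_one_power)
    fix k assume k: "k \<in> {1..p-1}"
    define u v where "u = 1 / rat_of_nat k" and "v = 1 / rat_of_nat (p - k)"
    have 1: "u + v = P * (u * v)" using inv_add_reflect[OF k] by (simp only: u_def v_def)
    obtain m where "k = Suc m" using k by (cases k) auto
    then have 2: "square_harm k = square_harm (k - 1) + u ^ 2"
      by (simp add: square_harm_def u_def)
    have "u * (square_harm (k - 1) + square_harm (p - k)) - P * (u * v * square_harm (p - k)) \<in> Ord 1"
    proof (intro Ord_diff)
      have "square_harm (k - 1) + square_harm (p - 1 - (k - 1)) \<in> Ord 1"
        by (rule square_harm_reflect) (use k in auto)
      then show "u * (square_harm (k - 1) + square_harm (p - k)) \<in> Ord 1"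
        unfolding u_def using k by (intro Ord_mult_left Ord_inv) auto
      show "P * (u * v * square_harm (p - k)) \<in> Ord 1"
        unfolding u_def v_def using k p_gt_3
        by (intro Ord_mult_right[OF Ord_p] Ord_intros Ord_square_harm) auto
    qed
    also have "u * (square_harm (k - 1) + square_harm (p - k)) - P * (u * v * square_harm (p - k))
       = square_harm k * u - square_harm (p - k) * v - u ^ 3"
      using 1 2 by algebra
    finally show "square_harm k * (1 / of_nat k) - square_harm (p - k) * (1 / of_nat (p - k))
        - (1 / of_nat k) ^ 3 \<in> Ord 1" by (simp only: u_def v_def)
  qed
  finally show ?thesis by (simp only: Z_def)
qed

text \<open>The second-order term of the product contributes -p^2 times the sum in
  \<open>alt_square_harm_sum\<close>, which lowers the coefficient 4 coming from
  \<open>alt_shift_sum\<close> to 3.\<close>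

lemma alt_shift_square_prod_sum:
  "2 * (\<Sum>k=1..p-1. (- 1) ^ k * (shift_inv k * square_prod k)) - 2 * alt_power_harm 1
     - 3 * P ^ 2 * alt_power_harm 3 \<in> Ord 3"
proof -
  define e e1 Z where "e = (\<Sum>k=1..p-1. (- 1) ^ k * (shift_inv k * square_prod k))"
    and "e1 = (\<Sum>k=1..p-1. (- 1) ^ k * shift_inv k)"
    and "Z = (\<Sum>k=1..p-1. (- 1) ^ k * (square_harm k * (1 / of_nat k)))"
  have "e - e1 + P ^ 2 * Z = (\<Sum>k=1..p-1. (- 1) ^ k *
      (shift_inv k * (square_prod k - 1) + P ^ 2 * (square_harm k * (1 / of_nat k))))"
    by (simp add: e_def e1_def Z_def sum.distrib sum_subtractf sum_distrib_left algebra_simps)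
  also have "\<dots> \<in> Ord 3"
  proof (intro Ord_sum Ord_minus_one_power)
    fix k assume k: "k \<in> {1..p-1}"
    define u w where "u = 1 / rat_of_nat k" and "w = shift_inv k"
    have "u * of_nat k = 1" "w * (P + of_nat k) = 1"
      using inv_mult[OF k] shift_inv_mult[of k] by (simp_all only: u_def w_def)
    then have "w * (square_prod k - 1) + P ^ 2 * (square_harm k * u) =
        w * (square_prod k - 1 + P ^ 2 * square_harm k) + P ^ 3 * (square_harm k * u * w)"
      by algebra
    also have "\<dots> \<in> Ord 3"
    proof (intro Ord_add)
      have "square_prod k - 1 + P ^ 2 * square_harm k \<in> Ord 3"
        by (rule Ord_mono[OF square_prod_cong(1)]) (use k in auto)
      then show "w * (square_prod k - 1 + P ^ 2 * square_harm k) \<in> Ord 3"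
        unfolding w_def by (intro Ord_mult_left Ord_shift_inv k)
      show "P ^ 3 * (square_harm k * u * w) \<in> Ord 3"
        unfolding u_def w_def using k
        by (intro Ord_mult_right[OF Ord_p_power] Ord_intros Ord_square_harm) auto
    qed
    finally show "shift_inv k * (square_prod k - 1) + P ^ 2 * (square_harm k * (1 / of_nat k)) \<in> Ord 3"
      by (simp only: u_def w_def)
  qed
  finally have "2 * (e - e1 + P ^ 2 * Z) \<in> Ord 3" by (rule Ord_mult_left[OF Ord_numeral])
  moreover have "2 * (e1 - alt_power_harm 1 - 2 * P ^ 2 * alt_power_harm 3) \<in> Ord 3"
    unfolding e1_def by (rule Ord_mult_left[OF Ord_numeral alt_shift_sum])
  moreover have "P ^ 2 * (2 * Z - alt_power_harm 3) \<in> Ord 3"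
    unfolding Z_def by (rule Ord_mult_eq[OF Ord_P2 alt_square_harm_sum]) simp
  ultimately have "2 * (e - e1 + P ^ 2 * Z) + 2 * (e1 - alt_power_harm 1 - 2 * P ^ 2 * alt_power_harm 3)
     - P ^ 2 * (2 * Z - alt_power_harm 3) \<in> Ord 3"
    using Ord_diff[OF Ord_add] by blast
  then show ?thesis unfolding e_def[symmetric] by (simp add: algebra_simps)
qed

end

section \<open>The Delannoy polynomial of index \<open>p - 1\<close>\<close>

lemma sum_atMost_remove_0: "(\<Sum>k\<le>n. f k) = f 0 + (\<Sum>k=1..n. f k)" for n :: nat
  by (simp add: atMost_atLeast0 sum.atLeast_Suc_atMost)

context large_prime_padic
begin

lemma of_nat_pred: "of_nat (p - 1) = P - 1"
  using p_gt_3 by (simp add: of_nat_diff)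

text \<open>With K = k + 1, one step of the recurrence multiplies the left-hand side by (p - K)(p +
  K)/K^2 = -(1 - p^2/K^2).\<close>

lemma delannoy_coeff_pred:
  "k < p \<Longrightarrow> delannoy_coeff (p - 1) k * (P + of_nat k) = P * ((- 1) ^ k * square_prod k)"
proof (induction k)
  case 0
  then show ?case by (simp add: square_prod_def)
next
  case (Suc k)
  define u where "u = 1 / rat_of_nat (Suc k)"
  define K where "K = rat_of_nat (Suc k)"
  define c c' where "c = delannoy_coeff (p - 1) k" and "c' = delannoy_coeff (p - 1) (Suc k)"
  have u: "u * K = 1" by (simp add: u_def K_def del: of_nat_Suc)
  have "K ^ 2 * c' = (P - K) * (P + of_nat k) * c"
    using delannoy_coeff_Suc_right[of k "p - 1"] unfolding of_nat_pred
    by (simp add: c_def c'_def K_def algebra_simps)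
  moreover define s :: rat where "s = (- 1) ^ k"
  have "c * (P + of_nat k) = P * (s * square_prod k)"
    using Suc by (simp add: c_def s_def)
  ultimately have "K ^ 2 * c' = (P - K) * (P * (s * square_prod k))" by algebra
  then have "c' * (P + K) = P * (- s * (square_prod k * (1 - P ^ 2 * u ^ 2)))"
    using u by algebra
  then show ?case
    by (simp add: c'_def K_def square_prod_def u_def s_def)
qed

text \<open>The coefficient divided by \<open>p\<close>. It is p-integral for \<open>k\<close> from
  1 to \<open>p - 1\<close> but equals 1/p at 0, so the constant term is always split off.\<close>

definition delannoy_quot :: "nat \<Rightarrow> rat" where
  "delannoy_quot k = (- 1) ^ k * (shift_inv k * square_prod k)"

lemma delannoy_coeff_eq_quot: "k < p \<Longrightarrow> delannoy_coeff (p - 1) k = P * delannoy_quot k"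
proof -
  assume "k < p"
  define s :: rat where "s = (- 1) ^ k"
  have "delannoy_coeff (p - 1) k * (P + of_nat k) = P * (s * square_prod k)"
    using delannoy_coeff_pred[OF \<open>k < p\<close>] by (simp add: s_def)
  then have "delannoy_coeff (p - 1) k = P * (s * (shift_inv k * square_prod k))"
    using shift_inv_mult[of k] by algebra
  then show ?thesis by (simp add: delannoy_quot_def s_def)
qed

lemma delannoy_coeff_eq_quot': "k \<in> {1..p-1} \<Longrightarrow> delannoy_coeff (p - 1) k = P * delannoy_quot k"
  by (rule delannoy_coeff_eq_quot) auto

lemma delannoy_pred: "of_nat (delannoy (p - 1)) = 1 + P * (\<Sum>k=1..p-1. delannoy_quot k)"
proof -
  have "of_nat (delannoy (p - 1)) = (\<Sum>k\<le>p-1. delannoy_coeff (p - 1) k)"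
    by (simp add: delannoy_def delannoy_coeff_def atMost_atLeast0)
  also have "\<dots> = 1 + (\<Sum>k=1..p-1. P * delannoy_quot k)"
    unfolding sum_atMost_remove_0
    by (intro arg_cong2[of _ _ _ _ "(+)"] sum.cong delannoy_coeff_eq_quot') auto
  finally show ?thesis by (simp add: sum_distrib_left)
qed

lemma schroeder_pred:
  "schroeder (p - 1) = 1 + P * (\<Sum>k=1..p-1. delannoy_quot k / of_nat (Suc k))"
proof -
  have "schroeder (p - 1) = (\<Sum>k\<le>p-1. delannoy_coeff (p - 1) k / of_nat (Suc k))"
    by (simp add: schroeder_def delannoy_coeff_def atMost_atLeast0)
  also have "\<dots> = 1 + (\<Sum>k=1..p-1. P * (delannoy_quot k / of_nat (Suc k)))"
    unfolding sum_atMost_remove_0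
    by (intro arg_cong2[of _ _ _ _ "(+)"] sum.cong)
       (simp_all add: delannoy_coeff_eq_quot' del: One_nat_def of_nat_Suc)
  finally show ?thesis by (simp add: sum_distrib_left)
qed

lemma integral_delannoy_pred:
  "poly_integral (delannoy_poly (p - 1) ^ 2) = 2 * schroeder (p - 1) - 1
     + P ^ 2 * (\<Sum>j=1..p-1. \<Sum>k=1..p-1. delannoy_quot j * delannoy_quot k / of_nat (Suc (j + k)))"
proof -
  define c where "c = delannoy_coeff (p - 1)"
  have c0: "c 0 = 1" by (simp add: c_def)
  have c: "c k = P * delannoy_quot k" if "k \<in> {1..p-1}" for k
    using that unfolding c_def by (rule delannoy_coeff_eq_quot')
  have S: "(\<Sum>k=1..p-1. c k / of_nat (Suc k)) = schroeder (p - 1) - 1"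
    unfolding schroeder_pred by (simp add: c sum_distrib_left)
  have "poly_integral (delannoy_poly (p - 1) ^ 2) =
     1 + 2 * (\<Sum>k=1..p-1. c k / of_nat (Suc k))
       + (\<Sum>j=1..p-1. \<Sum>k=1..p-1. c j * c k / of_nat (Suc (j + k)))"
    unfolding poly_integral_delannoy_poly_square c_def[symmetric] sum_atMost_remove_0
    by (simp add: c0 sum.distrib)
  also have "(\<Sum>j=1..p-1. \<Sum>k=1..p-1. c j * c k / of_nat (Suc (j + k))) =
     P ^ 2 * (\<Sum>j=1..p-1. \<Sum>k=1..p-1. delannoy_quot j * delannoy_quot k / of_nat (Suc (j + k)))"
    unfolding sum_distrib_left by (intro sum.cong) (auto simp: c power2_eq_square)
  finally show ?thesis unfolding S by simp
qed

text \<open>Write k c_k = (p + k) c_k - p c_k in \<open>schroeder_eq_sum\<close>, with c_k the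
  coefficient; the first part is p times a bare product, and a factor \<open>p\<close>
  cancels.\<close>

lemma schroeder_pred':
  "(P - 1) * schroeder (p - 1) =
     2 * ((\<Sum>k=1..p-1. (- 1) ^ k * square_prod k) - P * (\<Sum>k=1..p-1. delannoy_quot k))"
proof -
  have "(P - 1) * P * schroeder (p - 1) = of_nat (p - 1) * of_nat (Suc (p - 1)) * schroeder (p - 1)"
    unfolding of_nat_pred using p_gt_3 by simp
  also have "\<dots> = 2 * (\<Sum>k\<le>p-1. of_nat k * delannoy_coeff (p - 1) k)"
    by (rule schroeder_eq_sum) (use p_gt_3 in auto)
  also have "(\<Sum>k\<le>p-1. of_nat k * delannoy_coeff (p - 1) k) =
      (\<Sum>k=1..p-1. P * ((- 1) ^ k * square_prod k - P * delannoy_quot k))"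
    unfolding sum_atMost_remove_0
  proof (simp, intro sum.cong refl)
    fix k assume "k \<in> {Suc 0..p - Suc 0}"
    then have "k < p" by auto
    then have "delannoy_coeff (p - 1) k = P * delannoy_quot k"
      "delannoy_coeff (p - 1) k * (P + of_nat k) = P * ((- 1) ^ k * square_prod k)"
      by (rule delannoy_coeff_eq_quot, rule delannoy_coeff_pred)
    moreover have "K * c = P * (s - P * q)" if "c = P * q" "c * (P + K) = P * s" for c q K s
      using that by algebra
    ultimately have "of_nat k * delannoy_coeff (p - 1) k = P * ((- 1) ^ k * square_prod k - P * delannoy_quot k)"
      by blast
    then show "of_nat k * delannoy_coeff (p - Suc 0) k = P * ((- 1) ^ k * square_prod k - P * delannoy_quot k)"
      by simp
  qed
  finally have "P * ((P - 1) * schroeder (p - 1)) =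
     P * (2 * ((\<Sum>k=1..p-1. (- 1) ^ k * square_prod k) - P * (\<Sum>k=1..p-1. delannoy_quot k)))"
    by (simp add: sum_distrib_left sum_subtractf algebra_simps)
  then show ?thesis by simp
qed

section \<open>The double sum over 1/(j + k + 1)\<close>

definition alt_shift_inv :: "nat \<Rightarrow> rat" where
  "alt_shift_inv k = (- 1) ^ k * shift_inv k"

lemma Ord_alt_shift_inv: "k \<in> {1..p-1} \<Longrightarrow> alt_shift_inv k \<in> Ord 0"
  unfolding alt_shift_inv_def by (intro Ord_minus_one_power Ord_shift_inv)

text \<open>Replacing both products by 1 costs a multiple of p^2. Where j + k + 1 = p the
  denominator loses one power, and the reflected product, known modulo p^3, supplies it.\<close>

lemma double_sum_quot_cong:
  "(\<Sum>j=1..p-1. \<Sum>k=1..p-1. delannoy_quot j * delannoy_quot k / of_nat (Suc (j + k)))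
   - (\<Sum>j=1..p-1. \<Sum>k=1..p-1. alt_shift_inv j * alt_shift_inv k / of_nat (Suc (j + k))) \<in> Ord 2"
proof -
  have "(\<Sum>j=1..p-1. \<Sum>k=1..p-1. alt_shift_inv j * alt_shift_inv k *
      ((square_prod j * square_prod k - 1) / of_nat (Suc (j + k)))) \<in> Ord 2"
  proof (intro Ord_sum)
    fix j k assume jk: "j \<in> {1..p-1}" "k \<in> {1..p-1}"
    then have less: "j < p" "k < p" by auto
    have "(square_prod j * square_prod k - 1) / of_nat (Suc (j + k)) \<in> Ord 2"
    proof (cases "Suc (j + k) = p")
      case True
      then have "k = p - 1 - j" by simp
      then have "square_prod j * square_prod k - 1 \<in> Ord 3"
        using square_prod_reflect[OF less(1)] by simp
      then have "P ^ 1 * ((square_prod j * square_prod k - 1) / P) \<in> Ord (1 + 2)"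
        by (simp add: numeral_3_eq_3)
      then show ?thesis unfolding True by (rule Ord_p_power_mult_cancel)
    next
      case False
      then have "\<not> p dvd Suc (j + k)" using less by (intro not_dvd_less_double) auto
      moreover have "square_prod j * (square_prod k - 1) \<in> Ord 2"
        by (rule Ord_mult_left[OF Ord_square_prod[OF less(1)] square_prod_cong(2)[OF less(2)]])
      from Ord_add[OF this square_prod_cong(2)[OF less(1)]]
      have "square_prod j * square_prod k - 1 \<in> Ord 2" by (simp add: algebra_simps)
      ultimately show ?thesis by (intro Ord_divide_nat)
    qed
    then show "alt_shift_inv j * alt_shift_inv k * ((square_prod j * square_prod k - 1) / of_nat (Suc (j + k))) \<in> Ord 2"
      using jk by (intro Ord_mult_left Ord_alt_shift_inv)
  qed
  also have "(\<Sum>j=1..p-1. \<Sum>k=1..p-1. alt_shift_inv j * alt_shift_inv k *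
      ((square_prod j * square_prod k - 1) / of_nat (Suc (j + k)))) =
   (\<Sum>j=1..p-1. \<Sum>k=1..p-1. delannoy_quot j * delannoy_quot k / of_nat (Suc (j + k)))
   - (\<Sum>j=1..p-1. \<Sum>k=1..p-1. alt_shift_inv j * alt_shift_inv k / of_nat (Suc (j + k)))"
    unfolding sum_subtractf[symmetric]
    by (intro sum.cong refl)
       (simp add: delannoy_quot_def alt_shift_inv_def diff_divide_distrib right_diff_distrib
          mult.assoc mult.left_commute mult.commute)
  finally show ?thesis .
qed

text \<open>Partial fractions: (p - 1)/((p + k)(k + 1)) = 1/(k + 1) - 1/(p + k). The alternating sum
  of 1/(k + 1) is a shifted harmonic sum, with 1/p as its end term.\<close>

lemma alt_shift_inv_inverse_sum:
  "(P - 1) * (\<Sum>k=1..p-1. alt_shift_inv k / of_nat (Suc k)) =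
     - alt_power_harm 1 - 1 + 1 / P - (\<Sum>k=1..p-1. alt_shift_inv k)"
proof -
  have "(\<Sum>k=1..p-1. (- 1) ^ k * (1 / of_nat k + 1 / of_nat (Suc k))) = 1 / P - 1"
    using alternating_sum_telescope[of "\<lambda>k. 1 / rat_of_nat k" "p - 1"] odd_p p_gt_3 by simp
  then have 1: "(\<Sum>k=1..p-1. (- 1) ^ k / of_nat (Suc k)) = - alt_power_harm 1 - 1 + 1 / P"
    by (simp add: alt_power_harm_def distrib_left sum.distrib del: of_nat_Suc)
  have "(P - 1) * (\<Sum>k=1..p-1. alt_shift_inv k / of_nat (Suc k)) =
      (\<Sum>k=1..p-1. (- 1) ^ k / of_nat (Suc k) - alt_shift_inv k)"
    unfolding sum_distrib_left
  proof (intro sum.cong refl)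
    fix k
    define v where "v = 1 / rat_of_nat (Suc k)"
    have "v * (of_nat k + 1) = 1" by (simp add: v_def add.commute)
    then have "(P - 1) * (s * shift_inv k * v) = s * v - s * shift_inv k" for s
      using shift_inv_mult[of k] by algebra
    from this[of "(- 1) ^ k"] show "(P - 1) * (alt_shift_inv k / of_nat (Suc k)) = (- 1) ^ k / of_nat (Suc k) - alt_shift_inv k"
      by (simp add: v_def alt_shift_inv_def)
  qed
  then show ?thesis unfolding 1[symmetric] by (simp add: sum_subtractf)
qed

text \<open>The finite-sum form of integrating by parts in \<open>\<integral>\<^sub>0\<^sup>1 E(t)\<^sup>2 dt\<close>, where
  \<open>E(t) = \<Sum> (-1)\<^sup>k t\<^sup>k / (p + k)\<close> satisfies \<open>(1 + t) (t E' + p E) = t\<^sup>p - t\<close>.\<close>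

lemma double_sum_by_parts:
  "(1 - 2 * P) * (\<Sum>j=1..p-1. \<Sum>k=1..p-1. alt_shift_inv j * alt_shift_inv k / of_nat (Suc (j + k))) =
     2 * (\<Sum>k=1..p-1. alt_shift_inv k) ^ 2
     + 2 * P * (\<Sum>j=1..p-1. \<Sum>k=1..p-1. alt_shift_inv j * alt_shift_inv k / of_nat (j + k))
     + 2 * (\<Sum>k=1..p-1. alt_shift_inv k / of_nat (Suc k))
     - 2 * (\<Sum>k=1..p-1. (- 1) ^ k * shift_inv k ^ 2)"
  (is "(1 - 2 * P) * ?K = 2 * ?e ^ 2 + 2 * P * ?W + 2 * ?I - 2 * ?f")
proof -
  define A where "A = {1..p-1}"
  define Q where "Q = (\<Sum>j\<in>A. \<Sum>k\<in>A. (- 1) ^ j * alt_shift_inv k / rat_of_nat (j + k))"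
  define Q' where "Q' = (\<Sum>j\<in>A. \<Sum>k\<in>A. (- 1) ^ j * alt_shift_inv k / rat_of_nat (Suc (j + k)))"
  have sq: "?e ^ 2 = (\<Sum>j\<in>A. \<Sum>k\<in>A. alt_shift_inv j * alt_shift_inv k)"
    by (simp add: power2_eq_square sum_product A_def)
  have swapQ: "Q = (\<Sum>j\<in>A. \<Sum>k\<in>A. (- 1) ^ k * alt_shift_inv j / rat_of_nat (j + k))"
    unfolding Q_def by (subst sum.swap) (simp add: add.commute)
  have swapQ': "Q' = (\<Sum>j\<in>A. \<Sum>k\<in>A. (- 1) ^ k * alt_shift_inv j / rat_of_nat (Suc (j + k)))"
    unfolding Q'_def by (subst sum.swap) (simp add: add.commute)
  \<comment> \<open>Since (-1)^j = (p + j) \<open>alt_shift_inv j\<close>, symmetrizing gives the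
    numerator (p + j) + (p + k) = (j + k) + 2p.\<close>
  have "Q + Q = ?e ^ 2 + 2 * P * ?W"
  proof -
    have "Q + Q = (\<Sum>j\<in>A. \<Sum>k\<in>A. (- 1) ^ j * alt_shift_inv k / rat_of_nat (j + k)
        + (- 1) ^ k * alt_shift_inv j / rat_of_nat (j + k))"
      by (subst (2) swapQ) (simp add: Q_def sum.distrib)
    also have "\<dots> = (\<Sum>j\<in>A. \<Sum>k\<in>A. alt_shift_inv j * alt_shift_inv k
        + 2 * P * (alt_shift_inv j * alt_shift_inv k / of_nat (j + k)))"
    proof (intro sum.cong refl)
      fix j k assume "j \<in> A" "k \<in> A"
      define m where "m = 1 / rat_of_nat (j + k)"
      have m: "m * (of_nat j + of_nat k) = 1" using \<open>j \<in> A\<close> by (simp add: m_def A_def flip: of_nat_add)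
      have "(s * (t * shift_inv k)) * m + (t * (s * shift_inv j)) * m =
          (s * shift_inv j) * (t * shift_inv k) + 2 * P * ((s * shift_inv j) * (t * shift_inv k) * m)" for s t
        using m shift_inv_mult[of j] shift_inv_mult[of k] by algebra
      from this[of "(- 1) ^ j" "(- 1) ^ k"] show "(- 1) ^ j * alt_shift_inv k / rat_of_nat (j + k) + (- 1) ^ k * alt_shift_inv j / rat_of_nat (j + k) =
          alt_shift_inv j * alt_shift_inv k + 2 * P * (alt_shift_inv j * alt_shift_inv k / of_nat (j + k))"
        by (simp add: alt_shift_inv_def m_def)
    qed
    finally show ?thesis unfolding sq by (simp add: sum.distrib sum_distrib_left A_def)
  qed
  \<comment> \<open>The same symmetrization with numerator (j + k + 1) + (2p - 1).\<close>
  moreover have "(1 - 2 * P) * ?K = ?e ^ 2 - (Q' + Q')"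
  proof -
    have "?e ^ 2 - (Q' + Q') = (\<Sum>j\<in>A. \<Sum>k\<in>A. alt_shift_inv j * alt_shift_inv k
        - ((- 1) ^ j * alt_shift_inv k / rat_of_nat (Suc (j + k))
        + (- 1) ^ k * alt_shift_inv j / rat_of_nat (Suc (j + k))))"
      unfolding sq by (subst (2) swapQ') (simp add: Q'_def sum.distrib sum_subtractf)
    also have "\<dots> = (\<Sum>j\<in>A. \<Sum>k\<in>A. (1 - 2 * P) * (alt_shift_inv j * alt_shift_inv k / of_nat (Suc (j + k))))"
    proof (intro sum.cong refl)
      fix j k assume "j \<in> A" "k \<in> A"
      define m where "m = 1 / rat_of_nat (Suc (j + k))"
      have m: "m * (of_nat j + of_nat k + 1) = 1" by (simp add: m_def add.commute flip: of_nat_add of_nat_Suc)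
      have "(s * shift_inv j) * (t * shift_inv k) - ((s * (t * shift_inv k)) * m + (t * (s * shift_inv j)) * m) =
          (1 - 2 * P) * ((s * shift_inv j) * (t * shift_inv k) * m)" for s t
        using m shift_inv_mult[of j] shift_inv_mult[of k] by algebra
      from this[of "(- 1) ^ j" "(- 1) ^ k"] show "alt_shift_inv j * alt_shift_inv k - ((- 1) ^ j * alt_shift_inv k / rat_of_nat (Suc (j + k))
          + (- 1) ^ k * alt_shift_inv j / rat_of_nat (Suc (j + k))) =
          (1 - 2 * P) * (alt_shift_inv j * alt_shift_inv k / of_nat (Suc (j + k)))"
        by (simp add: alt_shift_inv_def m_def del: of_nat_Suc)
    qed
    finally show ?thesis by (simp add: sum_distrib_left A_def del: of_nat_Suc)
  qed
  \<comment> \<open>For fixed \<open>k\<close> the alternating sum over \<open>j\<close> of 1/(j +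
    k) + 1/(j + k + 1) telescopes to its two end terms.\<close>
  moreover have "Q + Q' = ?f - ?I"
  proof -
    have "Q + Q' = (\<Sum>k\<in>A. \<Sum>j\<in>A. (- 1) ^ j * alt_shift_inv k / rat_of_nat (j + k)
        + (- 1) ^ j * alt_shift_inv k / rat_of_nat (Suc (j + k)))"
      unfolding Q_def Q'_def by (subst (1 2) sum.swap) (simp add: sum.distrib del: of_nat_Suc)
    also have "\<dots> = (\<Sum>k\<in>A. (- 1) ^ k * shift_inv k ^ 2 - alt_shift_inv k / of_nat (Suc k))"
    proof (intro sum.cong refl)
      fix k
      have "(\<Sum>j\<in>A. (- 1) ^ j * (1 / rat_of_nat (j + k) + 1 / rat_of_nat (Suc j + k))) =
          shift_inv k - 1 / of_nat (Suc k)"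
        using alternating_sum_telescope[of "\<lambda>j. 1 / rat_of_nat (j + k)" "p - 1"] odd_p p_gt_3
        by (simp add: A_def shift_inv_def)
      then have "alt_shift_inv k * (\<Sum>j\<in>A. (- 1) ^ j * (1 / rat_of_nat (j + k) + 1 / rat_of_nat (Suc j + k))) =
          alt_shift_inv k * (shift_inv k - 1 / of_nat (Suc k))" by (simp only:)
      then show "(\<Sum>j\<in>A. (- 1) ^ j * alt_shift_inv k / rat_of_nat (j + k)
          + (- 1) ^ j * alt_shift_inv k / rat_of_nat (Suc (j + k))) =
          (- 1) ^ k * shift_inv k ^ 2 - alt_shift_inv k / of_nat (Suc k)"
        unfolding sum_distrib_left
        by (simp add: alt_shift_inv_def power2_eq_square right_diff_distrib distrib_left mult.assoc
            mult.left_commute mult.commute del: of_nat_Suc of_nat_add)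
    qed
    finally show ?thesis by (simp add: sum_subtractf A_def del: of_nat_Suc)
  qed
  ultimately show ?thesis by algebra
qed

text \<open>Under (j, k) -> (p - j, p - k) each \<open>alt_shift_inv\<close> is unchanged modulo
  \<open>p\<close>, while 1/(j + k) changes sign, so the terms cancel in pairs.\<close>

lemma nonsingular_double_sum:
  "(\<Sum>j=1..p-1. \<Sum>k=1..p-1. if j + k = p then 0 else alt_shift_inv j * alt_shift_inv k / of_nat (j + k)) \<in> Ord 1"
  (is "?R \<in> _")
proof (rule Ord_halve)
  define g where "g j k = (if j + k = p then 0 else alt_shift_inv j * alt_shift_inv k / of_nat (j + k))" for j k
  have "(\<Sum>j=1..p-1. \<Sum>k=1..p-1. g j k) = (\<Sum>j=1..p-1. \<Sum>k=1..p-1. g j (p - k))"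
    by (rule sum.cong[OF refl sum_reflect])
  also have "\<dots> = (\<Sum>j=1..p-1. \<Sum>k=1..p-1. g (p - j) (p - k))"
    by (rule sum_reflect)
  finally have 1: "(\<Sum>j=1..p-1. \<Sum>k=1..p-1. g j k) = (\<Sum>j=1..p-1. \<Sum>k=1..p-1. g (p - j) (p - k))" .
  have 2: "?R = (\<Sum>j=1..p-1. \<Sum>k=1..p-1. g j k)"
    by (simp only: g_def)
  have "2 * ?R = (\<Sum>j=1..p-1. \<Sum>k=1..p-1. g j k + g (p - j) (p - k))"
    unfolding 2 mult_2 sum.distrib by (simp only: 1)
  also have "\<dots> \<in> Ord 1"
  proof (intro Ord_sum)
    fix j k assume jk: "j \<in> {1..p-1}" "k \<in> {1..p-1}"
    show "g j k + g (p - j) (p - k) \<in> Ord 1"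
    proof (cases "j + k = p")
      case True
      then have "(p - j) + (p - k) = p" using jk by auto
      then show ?thesis using True by (simp add: g_def)
    next
      case False
      then have ne: "(p - j) + (p - k) \<noteq> p" using jk by auto
      define m n where "m = 1 / rat_of_nat (j + k)" and "n = 1 / rat_of_nat ((p - j) + (p - k))"
      have "\<not> p dvd j + k" by (rule not_dvd_less_double) (use jk False in auto)
      moreover have "\<not> p dvd (p - j) + (p - k)"
        by (rule not_dvd_less_double[OF _ _ ne]) (use jk in auto)
      ultimately have mn: "m \<in> Ord 0" "n \<in> Ord 0"
        unfolding m_def n_def by (blast intro: Ord_inverse_nat)+
      have m: "m * (of_nat j + of_nat k) = 1"
        using jk by (simp add: m_def flip: of_nat_add)
      have "rat_of_nat ((p - j) + (p - k)) = 2 * P - of_nat j - of_nat k"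
        using jk by (auto simp: of_nat_diff)
      moreover have "(p - j) + (p - k) \<noteq> 0" using jk by auto
      then have "n * rat_of_nat ((p - j) + (p - k)) = 1" by (simp add: n_def del: of_nat_add)
      ultimately have n: "n * (2 * P - of_nat j - of_nat k) = 1" by (simp only:)
      define a b c d where "a = shift_inv j" and "b = shift_inv k"
        and "c = shift_inv (p - j)" and "d = shift_inv (p - k)"
      have abcd: "a \<in> Ord 0" "b \<in> Ord 0" "c \<in> Ord 0" "d \<in> Ord 0"
        unfolding a_def b_def c_def d_def using jk by (auto intro: Ord_shift_inv Ord_shift_inv_reflect simp del: One_nat_def)
      have ac: "a + c = 3 * P * (a * c)" and bd: "b + d = 3 * P * (b * d)"
        unfolding a_def b_def c_def d_def using jk by (intro shift_inv_add_reflect; simp)+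
      have mn2: "m + n = P * (2 * m * n)" using m n by algebra
      have "a * b * m + c * d * n = P * (a * b * (2 * m * n) - 3 * a * c * b * n + 3 * c * (b * d) * n)"
        using ac bd mn2 by algebra
      also have "\<dots> \<in> Ord 1"
        by (intro Ord_mult_right[OF Ord_p] Ord_add Ord_diff Ord_mult_left Ord_numeral abcd mn)
      finally have "(- 1) ^ (j + k) * (a * b * m + c * d * n) \<in> Ord 1" by (rule Ord_minus_one_power)
      also have "(- 1) ^ (j + k) * (a * b * m + c * d * n) = g j k + g (p - j) (p - k)"
      proof -
        have "(- 1) ^ (p - j) = - ((- 1) ^ j :: rat)" "(- 1) ^ (p - k) = - ((- 1) ^ k :: rat)"
          using jk by (auto intro!: minus_one_power_reflect)
        then show ?thesis using False ne
          by (simp add: g_def alt_shift_inv_def a_def b_def c_def d_def m_def n_def power_add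
              distrib_left mult.assoc mult.left_commute mult.commute del: of_nat_add)
      qed
      finally show ?thesis .
    qed
  qed
  finally show "2 * ?R \<in> Ord 1" .
qed

text \<open>The terms with j + k = p have denominator \<open>p\<close> and opposite signs (-1)^j and
  (-1)^k; \<open>shift_inv_reflect_sum\<close> evaluates their sum, which explains the factor
  3p^2.\<close>

lemma double_sum_singular_part:
  "3 * P ^ 2 * (\<Sum>j=1..p-1. \<Sum>k=1..p-1. alt_shift_inv j * alt_shift_inv k / of_nat (j + k)) =
   3 * P ^ 2 * (\<Sum>j=1..p-1. \<Sum>k=1..p-1. if j + k = p then 0 else alt_shift_inv j * alt_shift_inv k / of_nat (j + k))
   - 2 * (\<Sum>k=1..p-1. shift_inv k)"
  (is "_ * ?W = _ * ?R - _")
proof -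
  have "?W - ?R = (\<Sum>j=1..p-1. - (1 / P) * (shift_inv j * shift_inv (p - j)))"
    unfolding sum_subtractf[symmetric]
  proof (intro sum.cong refl)
    fix j assume j: "j \<in> {1..p-1}"
    have "(\<Sum>k=1..p-1. alt_shift_inv j * alt_shift_inv k / of_nat (j + k)
        - (if j + k = p then 0 else alt_shift_inv j * alt_shift_inv k / of_nat (j + k))) =
      (\<Sum>k=1..p-1. if k = p - j then alt_shift_inv j * alt_shift_inv (p - j) / P else 0)"
      using j by (intro sum.cong) (auto simp flip: of_nat_add)
    also have "\<dots> = alt_shift_inv j * alt_shift_inv (p - j) / P"
      using j by (subst sum.delta) auto
    also have "\<dots> = - (1 / P) * (shift_inv j * shift_inv (p - j))"
    proof -
      have "(- 1) ^ (p - j) = - ((- 1) ^ j :: rat)" using j by (auto intro!: minus_one_power_reflect)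
      moreover have "(- 1) ^ j * (- 1) ^ j = (1 :: rat)" by (simp flip: power_add)
      ultimately show ?thesis unfolding alt_shift_inv_def
        by (simp add: mult.assoc mult.left_commute)
    qed
    finally show "(\<Sum>k=1..p-1. alt_shift_inv j * alt_shift_inv k / of_nat (j + k)
        - (if j + k = p then 0 else alt_shift_inv j * alt_shift_inv k / of_nat (j + k))) =
        - (1 / P) * (shift_inv j * shift_inv (p - j))" .
  qed
  also have "\<dots> = - (1 / P) * (\<Sum>k=1..p-1. shift_inv k * shift_inv (p - k))"
    by (simp add: sum_distrib_left)
  finally have "?W - ?R = - (1 / P) * (\<Sum>k=1..p-1. shift_inv k * shift_inv (p - k))" .
  then have "P * (?W - ?R) = - (\<Sum>k=1..p-1. shift_inv k * shift_inv (p - k))" by simp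
  then show ?thesis using shift_inv_reflect_sum by algebra
qed

section \<open>Assembling the congruence modulo p^4\<close>

lemma alt_harm_eq: "alt_harm (p - 1) = alt_power_harm 1"
  by (simp add: alt_harm_def alt_power_harm_def)

lemma sum_delannoy_schroeder_cong:
  "(\<Sum>k=1..p-1. of_nat (delannoy k) * schroeder k)
     - (2 * P ^ 3 * bernoulli (p - 3) - 2 * P * alt_harm (p - 1)) \<in> Ord 4"
proof -
  define T S B where "T = (\<Sum>k=1..p-1. of_nat (delannoy k) * schroeder k)"
    and "S = schroeder (p - 1)" and "B = bernoulli (p - 3)"
  define a1 a2 a3 h2 where "a1 = alt_power_harm 1" and "a2 = alt_power_harm 2"
    and "a3 = alt_power_harm 3" and "h2 = power_harm 2"
  define e e1 f h I where "e = (\<Sum>k=1..p-1. delannoy_quot k)" and "e1 = (\<Sum>k=1..p-1. alt_shift_inv k)"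
    and "f = (\<Sum>k=1..p-1. (- 1) ^ k * shift_inv k ^ 2)" and "h = (\<Sum>k=1..p-1. shift_inv k)"
    and "I = (\<Sum>k=1..p-1. alt_shift_inv k / of_nat (Suc k))"
  define Y where "Y = (\<Sum>k=1..p-1. (- 1) ^ k * square_prod k)"
  define K where "K = (\<Sum>j=1..p-1. \<Sum>k=1..p-1. delannoy_quot j * delannoy_quot k / of_nat (Suc (j + k)))"
  define K1 where "K1 = (\<Sum>j=1..p-1. \<Sum>k=1..p-1. alt_shift_inv j * alt_shift_inv k / of_nat (Suc (j + k)))"
  define W where "W = (\<Sum>j=1..p-1. \<Sum>k=1..p-1. alt_shift_inv j * alt_shift_inv k / of_nat (j + k))"
  define R where "R = (\<Sum>j=1..p-1. \<Sum>k=1..p-1. if j + k = p then 0 else alt_shift_inv j * alt_shift_inv k / of_nat (j + k))"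

  have a0: "a1 \<in> Ord 0" "a3 \<in> Ord 0" by (simp_all only: a1_def a3_def Ord_alt_power_harm)
  \<comment> \<open>Each \<open>r\<close> is the error of one proved congruence, so the rest is
    linear bookkeeping of error orders.\<close>
  define r1 r2 r3 r4 r5 r6 r7 r8 r9 where "r1 = 2 * Y + P ^ 2 * (h2 + a2)"
    and "r2 = 2 * e - 2 * a1 - 3 * P ^ 2 * a3" and "r3 = K - K1" and "r4 = e1 - a1 - 2 * P ^ 2 * a3"
    and "r5 = f + 3 * P * a3" and "r6 = 2 * h + 3 * P * h2" and "r7 = a2 + P * a3"
    and "r8 = 3 * h2 + 4 * P * a3" and "r9 = a3 + B / 2"
  note r_def = r1_def r2_def r3_def r4_def r5_def r6_def r7_def r8_def r9_def
  have r1: "r1 \<in> Ord 4"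
    using alt_square_prod_sum by (simp only: r1_def Y_def h2_def a2_def)
  have r2: "r2 \<in> Ord 3"
    using alt_shift_square_prod_sum by (simp only: r2_def e_def a1_def a3_def delannoy_quot_def)
  have r3: "r3 \<in> Ord 2"
    using double_sum_quot_cong by (simp only: r3_def K_def K1_def)
  have r4: "r4 \<in> Ord 3"
    using alt_shift_sum by (simp only: r4_def e1_def a1_def a3_def alt_shift_inv_def)
  have r5: "r5 \<in> Ord 2"
    using alt_shift_square_sum by (simp only: r5_def f_def a3_def)
  have r6: "r6 \<in> Ord 3"
    using shift_sum by (simp only: r6_def h_def h2_def)
  have r7: "r7 \<in> Ord 2"
    using alt_power_harm_2 by (simp only: r7_def a2_def a3_def)
  have r8: "r8 \<in> Ord 2"
    using power_harm_2 by (simp only: r8_def h2_def a3_def)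
  have r9: "r9 \<in> Ord 1"
    using alternating_cube_sum_bernoulli[OF p_gt_3]
    by (simp add: r9_def B_def a3_def alt_power_harm_def power_divide)
  have R: "R \<in> Ord 1"
    using nonsingular_double_sum by (simp only: R_def)

  have S_eq: "(P - 1) * S = 2 * (Y - P * e)"
    using schroeder_pred' by (simp only: S_def Y_def e_def)
  have K1_eq: "(1 - 2 * P) * K1 = 2 * e1 ^ 2 + 2 * P * W + 2 * I - 2 * f"
    using double_sum_by_parts by (simp only: K1_def e1_def W_def I_def f_def)
  have W_eq: "3 * P ^ 2 * W = 3 * P ^ 2 * R - 2 * h"
    using double_sum_singular_part by (simp only: W_def R_def h_def)
  \<comment> \<open>The term \<open>k = p - 1\<close> of \<open>I\<close> has denominator
    \<open>p\<close>; the factor \<open>P\<close> clears it.\<close>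
  have I_eq: "P * ((P - 1) * I) = - P * a1 - P + 1 - P * e1"
    unfolding I_def a1_def e1_def alt_shift_inv_inverse_sum by (simp add: algebra_simps)
  have T_eq: "T = (2 * P - 1) * (2 * S - 1 + P ^ 2 * K) - 1 - (P - 1) * (1 + P * e) * S"
  proof -
    have "rat_of_nat (2 * (p - 1) + 1) = 2 * P - 1" using of_nat_pred by simp
    then show ?thesis
      unfolding T_def sum_delannoy_schroeder integral_delannoy_pred delannoy_pred of_nat_pred
      by (simp only: S_def K_def e_def)
  qed

  \<comment> \<open>Errors of the four blocks of the exact formula: the Schroeder number, its
    product with the sum \<open>e\<close>, the double sum, and the single sum \<open>I\<close>. The
    factors 3 and \<open>P - 1\<close> stay because only 3 h2, 3 p^2 W, (p - 1) S and (p - 1) I have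
    been evaluated.\<close>
  define q1 q2 q3 q4 where "q1 = 3 * ((P - 1) * S) + 6 * P * a1 + 2 * P ^ 3 * a3"
    and "q2 = P * (P - 1) * e * S + 2 * P ^ 2 * a1 ^ 2"
    and "q3 = 3 * ((1 - 2 * P) * P ^ 2 * K1 - 2 * P ^ 2 * a1 ^ 2 - 2 * P ^ 2 * I) - 10 * P ^ 3 * a3"
    and "q4 = 2 * P ^ 2 * ((P - 1) * I) - 2 * P + 2 * P ^ 2 + 4 * P ^ 2 * a1"
  have P3a3: "P ^ 3 * a3 \<in> Ord 3" and P2a3: "P ^ 2 * a3 \<in> Ord 2" and P4a3: "P ^ 4 * a3 \<in> Ord 4"
    by (rule Ord_mult_right[OF Ord_p_power a0(2)])+
  have d: "e - a1 \<in> Ord 2" and d1: "e1 - a1 \<in> Ord 2"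
  proof -
    have "r2 \<in> Ord 2" by (rule Ord_mono[OF r2]) simp
    then have "r2 + 3 * (P ^ 2 * a3) \<in> Ord 2"
      by (rule Ord_add[OF _ Ord_mult_left[OF Ord_numeral P2a3]])
    moreover have "r4 \<in> Ord 2" by (rule Ord_mono[OF r4]) simp
    then have "r4 + 2 * (P ^ 2 * a3) \<in> Ord 2"
      by (rule Ord_add[OF _ Ord_mult_left[OF Ord_numeral P2a3]])
    moreover have "r2 + 3 * (P ^ 2 * a3) = 2 * (e - a1)" "r4 + 2 * (P ^ 2 * a3) = e1 - a1"
      unfolding r_def by algebra+
    ultimately show "e - a1 \<in> Ord 2" "e1 - a1 \<in> Ord 2" by (simp_all only: Ord_halve)
  qed
  have q1: "q1 \<in> Ord 4"
  proof -
    have "P * r2 \<in> Ord 4" by (rule Ord_mult_eq[OF Ord_p r2]) simp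
    moreover have "P ^ 2 * r8 \<in> Ord 4" by (rule Ord_mult_eq[OF Ord_P2 r8]) simp
    moreover have "P ^ 2 * r7 \<in> Ord 4" by (rule Ord_mult_eq[OF Ord_P2 r7]) simp
    ultimately have "3 * r1 - 3 * (P * r2) - P ^ 2 * r8 - 3 * (P ^ 2 * r7) \<in> Ord 4"
      using r1 by (meson Ord_diff Ord_mult_left Ord_numeral)
    moreover have "q1 = 3 * r1 - 3 * (P * r2) - P ^ 2 * r8 - 3 * (P ^ 2 * r7)"
      unfolding q1_def S_eq r_def by algebra
    ultimately show ?thesis by simp
  qed
  have q2: "q2 \<in> Ord 4"
  proof -
    \<comment> \<open>This is the error in (p - 1) S \<equiv> -2 p a1 modulo p^3, enough here since
      a further factor \<open>P\<close> is present.\<close>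
    define c where "c = (P - 1) * S + 2 * P * a1"
    have "q1 \<in> Ord 3" by (rule Ord_mono[OF q1]) simp
    then have "q1 - 2 * (P ^ 3 * a3) \<in> Ord 3"
      by (rule Ord_diff[OF _ Ord_mult_left[OF Ord_numeral P3a3]])
    moreover have "q1 - 2 * (P ^ 3 * a3) = 3 * c"
      unfolding q1_def c_def by algebra
    ultimately have c: "c \<in> Ord 3" using Ord_divide_nat[OF _ not_dvd_3, of "3 * c" 3] by simp
    have "P * (a1 * c) \<in> Ord 4"
      by (rule Ord_mult_eq[OF Ord_p Ord_mult_left[OF a0(1) c]]) simp
    moreover have "P ^ 2 * (a1 * (e - a1)) \<in> Ord 4"
      by (rule Ord_mult_eq[OF Ord_P2 Ord_mult_left[OF a0(1) d]]) simp
    moreover have "P * ((e - a1) * c) \<in> Ord 4"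
      by (rule Ord_mono[OF Ord_mult[OF Ord_p Ord_mult[OF d c]]]) simp
    ultimately have "P * (a1 * c) - 2 * (P ^ 2 * (a1 * (e - a1))) + P * ((e - a1) * c) \<in> Ord 4"
      by (meson Ord_add Ord_diff Ord_mult_left Ord_numeral)
    moreover have "q2 = P * (a1 * c) - 2 * (P ^ 2 * (a1 * (e - a1))) + P * ((e - a1) * c)"
      unfolding q2_def c_def by algebra
    ultimately show ?thesis by simp
  qed
  have q3: "q3 \<in> Ord 4"
  proof -
    have "2 * a1 + (e1 - a1) \<in> Ord 0"
      using a0(1) Ord_mono[OF d1, of 0] by (intro Ord_add Ord_mult_left) auto
    then have "P ^ 2 * ((e1 - a1) * (2 * a1 + (e1 - a1))) \<in> Ord 4"
      by (intro Ord_mult_eq[OF Ord_P2 Ord_mult_right[OF d1]]) auto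
    moreover have "P ^ 3 * R \<in> Ord 4" by (rule Ord_mult_eq[OF Ord_p_power R]) simp
    moreover have "P * r6 \<in> Ord 4" by (rule Ord_mult_eq[OF Ord_p r6]) simp
    moreover have "P ^ 2 * r8 \<in> Ord 4" by (rule Ord_mult_eq[OF Ord_P2 r8]) simp
    moreover have "P ^ 2 * r5 \<in> Ord 4" by (rule Ord_mult_eq[OF Ord_P2 r5]) simp
    ultimately have "6 * (P ^ 2 * ((e1 - a1) * (2 * a1 + (e1 - a1)))) + 6 * (P ^ 3 * R)
        - 2 * (P * r6) + 2 * (P ^ 2 * r8) - 6 * (P ^ 2 * r5) \<in> Ord 4"
      by (meson Ord_add Ord_diff Ord_mult_left Ord_numeral)
    moreover have "q3 = 6 * (P ^ 2 * ((e1 - a1) * (2 * a1 + (e1 - a1)))) + 6 * (P ^ 3 * R)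
        - 2 * (P * r6) + 2 * (P ^ 2 * r8) - 6 * (P ^ 2 * r5)"
      unfolding q3_def r_def using K1_eq W_eq by algebra
    ultimately show ?thesis by simp
  qed
  have q4: "q4 \<in> Ord 4"
  proof -
    have "P ^ 2 * (e1 - a1) \<in> Ord 4" by (rule Ord_mult_eq[OF Ord_P2 d1]) simp
    then have "- 2 * (P ^ 2 * (e1 - a1)) \<in> Ord 4"
      using Ord_uminus[OF Ord_mult_left[OF Ord_numeral, of _ 4]] by simp
    moreover have "q4 = - 2 * (P ^ 2 * (e1 - a1))"
      unfolding q4_def using I_eq by algebra
    ultimately show ?thesis by simp
  qed
  have q5: "P ^ 2 * r3 \<in> Ord 4" by (rule Ord_mult_eq[OF Ord_P2 r3]) simp
  have q6: "P ^ 3 * r9 \<in> Ord 4" by (rule Ord_mult_eq[OF Ord_p_power r9]) simp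

  define T' where "T' = T - (2 * P ^ 3 * B - 2 * P * a1)"
  have P0: "P \<in> Ord 0" by simp
  \<comment> \<open>An exact identity: every summand is a multiple of a quantity divisible by p^4.
    The factors 3 and p - 1 are units at \<open>p\<close> and are divided out afterwards.\<close>
  have "3 * (of_nat (p - 1) * T') = (3 * P - 1) * q1 - 3 * ((P - 1) * q2) - (P - 1) * q3 - 3 * q4
      - 3 * ((P - 1) * ((1 - 2 * P) * (P ^ 2 * r3))) - 12 * ((P - 1) * (P ^ 3 * r9)) - 4 * (P ^ 4 * a3)"
    unfolding of_nat_pred T'_def T_eq q1_def q2_def q3_def q4_def r3_def r9_def
    by (simp add: field_simps) algebra
  also have "\<dots> \<in> Ord 4"
    by (intro Ord_diff Ord_mult_left Ord_numeral Ord_1 P0 q1 q2 q3 q4 q5 q6 P4a3)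
  finally have "3 * (of_nat (p - 1) * T') / of_nat 3 / of_nat (p - 1) \<in> Ord 4"
    by (intro Ord_divide_nat not_dvd_3 not_dvd_pred)
  then have "T' \<in> Ord 4" using p_gt_3 by (simp del: of_nat_diff)
  then show ?thesis by (simp only: T'_def T_def B_def a1_def alt_harm_eq)
qed

end

theorem theorem1p3:
  fixes p :: nat
  assumes "prime p" and "p > 3"
  shows "rat_cong p 4
           (\<Sum>k=1..p-1. of_nat (delannoy k) * schroeder k)
           (2 * of_nat p ^ 3 * bernoulli (p - 3) - 2 * of_nat p * alt_harm (p - 1))"
proof -
  interpret large_prime_padic p by unfold_locales (fact assms)+
  show ?thesis unfolding rat_cong_iff_diff by (rule sum_delannoy_schroeder_cong)
qed

end
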